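(* Fix an integer $r\ge2$. For $p$ prime let $S_p$ range over the surfaces isogenous to a product with $q=0$ and with group $G_p:=(\mathbb{Z}/p\mathbb{Z})^r$ admitting a ramification structure of type $(\tau_p,\tau_p)$, where $\tau_p=(p,\dots,p)$ ($p$ appears $r+1$ times). If $h(G_p;\tau_p,\tau_p)$ denotes the number of connected components of the moduli space of isomorphism classes of surfaces isogenous to a product with $q=0$ admitting these data, then, as $p\to\infty$, $$h(G_p;\tau_p,\tau_p)=\Theta\bigl(\chi(S_p)^{r}\bigr).$$
   Context: Asymptotic notation: $f(p)=\Theta(g(p))$ means that there are constants $c_1,c_2>0$ (independent of $p$) with $c_1g(p)\le f(p)\le c_2g(p)$ as $p\to\infty$. Surfaces. A (complex) surface $S$ is isogenous to a higher product of curves, of unmixed type, if $S=(C_1\times C_2)/G$ with $C_1,C_2$ curves of genus at least $2$ and $G$ a finite group acting freely and diagonally on $C_1\times C_2$; $G$ is taken minimal, i.e. no nontrivial element acts trivially on one of the factors. One has $q(S)=h^0(S,\Omega^1_S)=0$ iff $C_1/G\cong C_2/G\cong\mathbb{P}^1$. Only unmixed surfaces are considered. Group-theoretic data. For $k\ge 3$, a spherical $k$-system of generators of a finite group $G$ is a tuple $T=(x_1,\dots,x_k)\in G^k$ with $\langle x_1,\dots,x_k\rangle=G$ and $x_1\cdots x_k=1$. It has type $(m_1,\dots,m_k)$ if $\mathrm{ord}(x_i)=m_i$ for all $i$. Put $\Sigma(T)=\bigcup_{g\in G}\bigcup_{j\ge0}\bigcup_{i} g x_i^{j}g^{-1}$;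 $T_1,T_2$ are disjoint if $\Sigma(T_1)\cap\Sigma(T_2)=\{1\}$. An unmixed ramification structure of type $(\tau_1,\tau_2)$ for $G$ is a pair of disjoint spherical systems of generators of types $\tau_1,\tau_2$ (all entries at least $2$). Surfaces $S=(C_1\times C_2)/G$ isogenous to a higher product of curves, of unmixed type, with $q=0$, group $G$ and type $(\tau_1,\tau_2)$ correspond to such structures, and $\chi(S)=1+p_g-q$ depends only on the data: for $\tau_1=\tau_2=(m_1,\dots,m_k)$, $4\chi(S)=|G|\bigl(-2+\sum_{i=1}^{k}(1-\tfrac1{m_i})\bigr)^2$. For $\tau_1=\tau_2=\tau$ of length $k$ with all entries equal, $h(G;\tau,\tau)$ equals (by Bauer-Catanese) the number of orbits on the set $\mathcal{U}(G;\tau,\tau)$ of pairs $(T_1,T_2)$ of disjoint spherical $k$-systems of generators of type $\tau$ under $(\mathbf{B}_k\wr\mathbb{Z}/2\mathbb{Z})\times\mathrm{Aut}(G)$, where the braid group $\mathbf{B}_k=\langle\sigma_1,\dots,\sigma_{k-1}\rangle$ acts on each of $T_1,T_2$ independently by $\sigma_i:(x_1,\dots,x_k)\mapsto(x_1,\dots,x_{i-1},x_ix_{i+1}x_i^{-1},x_i,x_{i+2},\dots,x_k)$, $\mathbb{Z}/2\mathbb{Z}$ exchanges $T_1$ and $T_2$, and $\mathrm{Aut}(G)$ acts simultaneously on $T_1$ and $T_2$. *)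

theory Defs
  imports
    "HOL-Algebra.Group_Action"
    "HOL-Algebra.Elementary_Groups"
    "HOL-Algebra.Product_Groups"
    "HOL-Algebra.Multiplicative_Group"
    "HOL-Computational_Algebra.Primes"
    "HOL-Library.Landau_Symbols"
begin

section \<open>Spherical systems of generators and unmixed ramification structures\<close>

definition prod_tuple :: "('a, 'b) monoid_scheme \<Rightarrow> 'a list \<Rightarrow> 'a"
  where "prod_tuple G T = foldr (\<otimes>\<^bsub>G\<^esub>) T \<one>\<^bsub>G\<^esub>"

definition spherical_system :: "('a, 'b) monoid_scheme \<Rightarrow> 'a list \<Rightarrow> bool"
  where "spherical_system G T \<longleftrightarrow>
    3 \<le> length T \<and> set T \<subseteq> carrier G \<and>
    generate G (set T) = carrier G \<and> prod_tuple G T = \<one>\<^bsub>G\<^esub>"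

definition has_type :: "('a, 'b) monoid_scheme \<Rightarrow> 'a list \<Rightarrow> nat list \<Rightarrow> bool"
  where "has_type G T \<tau> \<longleftrightarrow> map (group.ord G) T = \<tau>"

definition stabilizer_set :: "('a, 'b) monoid_scheme \<Rightarrow> 'a list \<Rightarrow> 'a set"
  where "stabilizer_set G T =
    {g \<otimes>\<^bsub>G\<^esub> x [^]\<^bsub>G\<^esub> (j :: nat) \<otimes>\<^bsub>G\<^esub> inv\<^bsub>G\<^esub> g | g x j. g \<in> carrier G \<and> x \<in> set T}"

definition disjoint_systems :: "('a, 'b) monoid_scheme \<Rightarrow> 'a list \<Rightarrow> 'a list \<Rightarrow> bool"
  where "disjoint_systems G T\<^sub>1 T\<^sub>2 \<longleftrightarrow> stabilizer_set G T\<^sub>1 \<inter> stabilizer_set G T\<^sub>2 = {\<one>\<^bsub>G\<^esub>}"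

definition unmixed_structures ::
    "('a, 'b) monoid_scheme \<Rightarrow> nat list \<Rightarrow> nat list \<Rightarrow> ('a list \<times> 'a list) set"
  where "unmixed_structures G \<tau>\<^sub>1 \<tau>\<^sub>2 =
    {(T\<^sub>1, T\<^sub>2).
      spherical_system G T\<^sub>1 \<and> has_type G T\<^sub>1 \<tau>\<^sub>1 \<and>
      spherical_system G T\<^sub>2 \<and> has_type G T\<^sub>2 \<tau>\<^sub>2 \<and>
      (\<forall>m \<in> set \<tau>\<^sub>1 \<union> set \<tau>\<^sub>2. 2 \<le> m) \<and> disjoint_systems G T\<^sub>1 T\<^sub>2}"

text \<open>
  The holomorphic Euler characteristic of a surface isogenous to a product with \<open>q = 0\<close>, group
  \<open>G\<close> and type \<open>(\<tau>, \<tau>)\<close>, in terms of these data.  With \<open>C\<^sub>1\<close> and \<open>C\<^sub>2\<close> the two curves,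
  \<open>\<chi>(S) = (g(C\<^sub>1) - 1) (g(C\<^sub>2) - 1) / |G|\<close>, and Riemann--Hurwitz for \<open>C\<^sub>i \<rightarrow> C\<^sub>i/G = \<bbbP>\<^sup>1\<close> gives
  the formula.
\<close>

definition euler_char :: "('a, 'b) monoid_scheme \<Rightarrow> nat list \<Rightarrow> real"
  where "euler_char G \<tau> = real (order G) * (- 2 + (\<Sum>m\<leftarrow>\<tau>. 1 - 1 / real m))\<^sup>2 / 4"


section \<open>Connected components of the moduli space\<close>

text \<open>Indices start at 0, so \<^term>\<open>i\<close> runs over \<open>0, \<dots>, k - 2\<close>.\<close>

definition braid_move :: "('a, 'b) monoid_scheme \<Rightarrow> nat \<Rightarrow> 'a list \<Rightarrow> 'a list"
  where "braid_move G i T =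
    T[i := T ! i \<otimes>\<^bsub>G\<^esub> T ! Suc i \<otimes>\<^bsub>G\<^esub> inv\<^bsub>G\<^esub> (T ! i), Suc i := T ! i]"

text \<open>
  \<open>hurwitz_moves G k U\<close> consists of the permutations of a set \<open>U\<close> of pairs of \<open>k\<close>-tuples that are
  induced by the standard generators \<open>\<sigma>\<^sub>i\<close> of the two copies of the braid group \<open>B\<^sub>k\<close>, by the
  exchange of the two tuples, and by the automorphisms of \<open>G\<close>.  The subgroup of the permutation
  group of \<open>U\<close> that they generate is the image of \<open>(B\<^sub>k \<wr> \<int>/2) \<times> Aut(G)\<close>; its orbits are the
  orbits of that group.
\<close>

definition hurwitz_moves ::
    "('a, 'b) monoid_scheme \<Rightarrow> nat \<Rightarrow> ('a list \<times> 'a list) set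
      \<Rightarrow> ('a list \<times> 'a list \<Rightarrow> 'a list \<times> 'a list) set"
  where "hurwitz_moves G k U =
    {\<lambda>(T\<^sub>1, T\<^sub>2) \<in> U. (braid_move G i T\<^sub>1, T\<^sub>2) | i. Suc i < k} \<union>
    {\<lambda>(T\<^sub>1, T\<^sub>2) \<in> U. (T\<^sub>1, braid_move G i T\<^sub>2) | i. Suc i < k} \<union>
    {\<lambda>(T\<^sub>1, T\<^sub>2) \<in> U. (T\<^sub>2, T\<^sub>1)} \<union>
    {\<lambda>(T\<^sub>1, T\<^sub>2) \<in> U. (map \<alpha> T\<^sub>1, map \<alpha> T\<^sub>2) | \<alpha>. \<alpha> \<in> auto G}"

text \<open>
  \<open>num_components G k m\<close> is \<open>h(G; \<tau>, \<tau>)\<close> for \<open>\<tau> = (m, \<dots>, m)\<close> of length \<open>k\<close>, as computed by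
  Bauer and Catanese.  All entries of the type have to agree: otherwise the braid moves do not
  preserve the set of structures of that type.  That they do in the present case is the lemma
  \<open>hurwitz_moves_permute\<close> below.
\<close>

definition num_components :: "('a, 'b) monoid_scheme \<Rightarrow> nat \<Rightarrow> nat \<Rightarrow> nat"
  where "num_components G k m =
    (let U = unmixed_structures G (replicate k m) (replicate k m)
     in card (orbits (subgroup_generated (BijGroup U) (hurwitz_moves G k U)) U (\<lambda>g. g)))"

context group
begin

lemma prod_tuple_append:
  assumes "set xs \<subseteq> carrier G" "set ys \<subseteq> carrier G"
  shows "prod_tuple G (xs @ ys) = prod_tuple G xs \<otimes> prod_tuple G ys"
proof -
  have c: "set zs \<subseteq> carrier G \<Longrightarrow> prod_tuple G zs \<in> carrier G" for zs
    by (induction zs) (auto simp: prod_tuple_def)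
  show ?thesis
    using assms
  proof (induction xs)
    case Nil
    then show ?case using c[of ys] by (simp add: prod_tuple_def)
  next
    case (Cons x xs)
    then show ?case using c[of xs] c[of ys] by (simp add: prod_tuple_def m_assoc)
  qed
qed

lemma inv_mult_cancel: "\<lbrakk>a \<in> carrier G; b \<in> carrier G\<rbrakk> \<Longrightarrow> inv a \<otimes> (a \<otimes> b) = b"
  by (simp add: m_assoc[symmetric])

lemma conj_pow:
  assumes "a \<in> carrier G" "b \<in> carrier G"
  shows "(a \<otimes> b \<otimes> inv a) [^] (n :: nat) = a \<otimes> b [^] n \<otimes> inv a"
proof (induction n)
  case (Suc n)
  then show ?case
    using assms by (simp add: m_assoc inv_mult_cancel)
qed (use assms in simp)

lemma ord_conj:
  assumes "a \<in> carrier G" "b \<in> carrier G"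
  shows "ord (a \<otimes> b \<otimes> inv a) = ord b"
proof -
  have "a \<otimes> y \<otimes> inv a = \<one> \<longleftrightarrow> y = \<one>" if "y \<in> carrier G" for y
  proof
    assume "a \<otimes> y \<otimes> inv a = \<one>"
    then have "a \<otimes> y = a"
      using assms that by (metis inv_closed inv_equality inv_inv m_closed)
    then show "y = \<one>"
      using assms that by (metis l_cancel_one)
  qed (use assms in simp)
  then show ?thesis
    using assms by (auto simp: ord_unique conj_pow pow_eq_id)
qed

lemma braid_move_Cons_append:
  "braid_move G (length xs) (xs @ a # b # ys) = xs @ (a \<otimes> b \<otimes> inv a) # a # ys"
  by (simp add: braid_move_def nth_append list_update_append)

lemma nth_decomp2:
  assumes "Suc i < length T"
  obtains xs a b ys where "T = xs @ a # b # ys" "length xs = i"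
  by (metis Cons_nth_drop_Suc Suc_lessD append_take_drop_id assms length_take min.absorb4)

lemma braid_move_system:
  assumes T: "set T \<subseteq> carrier G" and i: "Suc i < length T"
  shows "set (braid_move G i T) \<subseteq> carrier G" (is ?A)
    and "generate G (set (braid_move G i T)) = generate G (set T)" (is ?B)
    and "prod_tuple G (braid_move G i T) = prod_tuple G T" (is ?C)
    and "stabilizer_set G (braid_move G i T) = stabilizer_set G T" (is ?D)
proof -
  obtain xs a b ys where d: "T = xs @ a # b # ys" "length xs = i"
    using nth_decomp2[OF i] .
  define c where "c = a \<otimes> b \<otimes> inv a"
  have T': "braid_move G i T = xs @ c # a # ys"
    using braid_move_Cons_append d c_def by auto
  have [simp]: "a \<in> carrier G" "b \<in> carrier G" "c \<in> carrier G"
    and xy: "set xs \<subseteq> carrier G" "set ys \<subseteq> carrier G"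
    using T d by (auto simp: c_def)
  have b: "b = inv a \<otimes> c \<otimes> inv (inv a)"
    by (simp add: c_def m_assoc inv_solve_left)
  show A: ?A using xy by (simp add: T')
  have "c \<in> generate G (set T)"
    unfolding c_def by (intro generate.eng generate.incl generate.inv) (auto simp: d)
  then have 1: "set (braid_move G i T) \<subseteq> generate G (set T)"
    by (auto simp: T'[unfolded d] d intro: generate.incl)
  have "b \<in> generate G (set (braid_move G i T))"
    unfolding b inv_inv[OF \<open>a \<in> carrier G\<close>]
    by (intro generate.eng generate.incl generate.inv) (auto simp: T')
  then have 2: "set T \<subseteq> generate G (set (braid_move G i T))"
    by (auto simp: T'[unfolded d] d intro: generate.incl)
  show ?B
    using generate_subgroup_incl[OF 1 generate_is_subgroup[OF T]]
      generate_subgroup_incl[OF 2 generate_is_subgroup[OF A]] by blast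
  have "prod_tuple G [c, a] = prod_tuple G [a, b]"
    by (simp add: prod_tuple_def c_def m_assoc)
  moreover have "T = xs @ [a, b] @ ys" "braid_move G i T = xs @ [c, a] @ ys"
    using d T' by simp_all
  ultimately show ?C
    using xy by (simp add: prod_tuple_append del: append_Cons)
  have conj: "\<exists>g'\<in>carrier G. g \<otimes> (h \<otimes> x \<otimes> inv h) [^] j \<otimes> inv g = g' \<otimes> x [^] j \<otimes> inv g'"
    if "g \<in> carrier G" "h \<in> carrier G" "x \<in> carrier G" for g h x and j :: nat
    unfolding conj_pow[OF that(2,3)] using that
    by (intro bexI[of _ "g \<otimes> h"]) (simp_all add: m_assoc inv_mult_group)
  have sub: "stabilizer_set G X \<subseteq> stabilizer_set G Y"
    if "\<And>x. x \<in> set X \<Longrightarrow> x \<in> set Y \<or> (\<exists>h\<in>carrier G. \<exists>y\<in>set Y. x = h \<otimes> y \<otimes> inv h)"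
      and Y: "set Y \<subseteq> carrier G" for X Y
  proof
    fix z assume "z \<in> stabilizer_set G X"
    then obtain g x and j :: nat where z: "g \<in> carrier G" "x \<in> set X" "z = g \<otimes> x [^] j \<otimes> inv g"
      by (auto simp: stabilizer_set_def)
    from that(1)[OF z(2)] show "z \<in> stabilizer_set G Y"
    proof (elim disjE bexE)
      fix h y assume h: "h \<in> carrier G" "y \<in> set Y" "x = h \<otimes> y \<otimes> inv h"
      obtain g' where "g' \<in> carrier G" "z = g' \<otimes> y [^] j \<otimes> inv g'"
        using conj[OF z(1) h(1)] h Y z by blast
      then show ?thesis using h by (auto simp: stabilizer_set_def)
    qed (use z in \<open>auto simp: stabilizer_set_def\<close>)
  qed
  show ?D
  proof
    show "stabilizer_set G (braid_move G i T) \<subseteq> stabilizer_set G T"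
    proof (rule sub[OF _ T])
      fix x assume "x \<in> set (braid_move G i T)"
      then show "x \<in> set T \<or> (\<exists>h\<in>carrier G. \<exists>y\<in>set T. x = h \<otimes> y \<otimes> inv h)"
        using \<open>a \<in> carrier G\<close> by (auto simp: T'[unfolded d] d c_def)
    qed
    show "stabilizer_set G T \<subseteq> stabilizer_set G (braid_move G i T)"
    proof (rule sub[OF _ A])
      fix x assume x: "x \<in> set T"
      have "\<exists>h\<in>carrier G. b = h \<otimes> c \<otimes> inv h"
        using b \<open>a \<in> carrier G\<close> by blast
      then show "x \<in> set (braid_move G i T) \<or>
          (\<exists>h\<in>carrier G. \<exists>y\<in>set (braid_move G i T). x = h \<otimes> y \<otimes> inv h)"
        using x by (auto simp: T'[unfolded d] d)
    qed
  qed
qed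

lemma braid_move_type:
  assumes "set T \<subseteq> carrier G" "Suc i < length T" "has_type G T (replicate k m)"
  shows "has_type G (braid_move G i T) (replicate k m)"
proof -
  obtain xs a b ys where d: "T = xs @ a # b # ys" "length xs = i"
    using nth_decomp2[OF assms(2)] .
  have e: "braid_move G i T = xs @ (a \<otimes> b \<otimes> inv a) # a # ys"
    using braid_move_Cons_append d by auto
  have "map ord T = replicate k m"
    using assms by (simp add: has_type_def)
  then have "length T = k" "\<forall>x\<in>set T. ord x = m"
    by (metis length_map length_replicate, metis in_set_replicate image_eqI list.set_map)
  moreover have "ord (a \<otimes> b \<otimes> inv a) = ord b"
    using assms d by (intro ord_conj) auto
  ultimately show ?thesis
    unfolding has_type_def e by (auto simp: d intro!: replicate_eqI)
qed

lemma braid_move_inj: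
  assumes "set S \<subseteq> carrier G" "set T \<subseteq> carrier G" "Suc i < length S" "length S = length T"
    and eq: "braid_move G i S = braid_move G i T"
  shows "S = T"
proof -
  obtain xs a b ys where S: "S = xs @ a # b # ys" "length xs = i"
    using nth_decomp2[OF assms(3)] .
  obtain xs' a' b' ys' where T: "T = xs' @ a' # b' # ys'" "length xs' = i"
    using nth_decomp2 assms by metis
  have "xs @ (a \<otimes> b \<otimes> inv a) # a # ys = xs' @ (a' \<otimes> b' \<otimes> inv a') # a' # ys'"
    using eq braid_move_Cons_append S T by metis
  then have "xs = xs'" "a = a'" "ys = ys'" "a \<otimes> b \<otimes> inv a = a \<otimes> b' \<otimes> inv a"
    using S T by auto
  moreover from this have "b = b'"
    using assms(1,2) S T by (auto simp: right_cancel)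
  ultimately show ?thesis by (simp add: S T)
qed

lemma auto_system:
  assumes \<alpha>: "\<alpha> \<in> auto G" and T: "set T \<subseteq> carrier G"
  shows "set (map \<alpha> T) \<subseteq> carrier G"
    and "generate G (set (map \<alpha> T)) = \<alpha> ` generate G (set T)"
    and "prod_tuple G (map \<alpha> T) = \<alpha> (prod_tuple G T)"
    and "stabilizer_set G (map \<alpha> T) = \<alpha> ` stabilizer_set G T"
    and "map ord (map \<alpha> T) = map ord T"
proof -
  have hom: "\<alpha> \<in> hom G G" and bij: "bij_betw \<alpha> (carrier G) (carrier G)"
    using \<alpha> by (auto simp: auto_def Bij_def)
  interpret \<alpha>: group_hom G G \<alpha>
    using hom by unfold_locales
  show "set (map \<alpha> T) \<subseteq> carrier G"
    using T by auto
  show "generate G (set (map \<alpha> T)) = \<alpha> ` generate G (set T)"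
    using \<alpha>.generate_img[OF T] by simp
  have "prod_tuple G (map \<alpha> T) = \<alpha> (prod_tuple G T) \<and> prod_tuple G T \<in> carrier G"
    using T by (induction T) (auto simp: prod_tuple_def)
  then show "prod_tuple G (map \<alpha> T) = \<alpha> (prod_tuple G T)" ..
  have pow: "\<alpha> (g \<otimes> x [^] j \<otimes> inv g) = \<alpha> g \<otimes> \<alpha> x [^] j \<otimes> inv (\<alpha> g)"
    if "g \<in> carrier G" "x \<in> carrier G" for g x and j :: nat
    using that by (simp add: \<alpha>.hom_nat_pow)
  show "stabilizer_set G (map \<alpha> T) = \<alpha> ` stabilizer_set G T"
  proof (intro equalityI subsetI)
    fix z assume "z \<in> stabilizer_set G (map \<alpha> T)"
    then obtain g x and j :: nat
      where z: "g \<in> carrier G" "x \<in> set T" "z = g \<otimes> \<alpha> x [^] j \<otimes> inv g"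
      by (auto simp: stabilizer_set_def)
    obtain h where h: "h \<in> carrier G" "g = \<alpha> h"
      using bij z(1) by (auto simp: bij_betw_def)
    have "z = \<alpha> (h \<otimes> x [^] j \<otimes> inv h)"
      using z h T pow by auto
    then show "z \<in> \<alpha> ` stabilizer_set G T"
      using h z by (auto simp: stabilizer_set_def)
  next
    fix z assume "z \<in> \<alpha> ` stabilizer_set G T"
    then obtain g x and j :: nat
      where z: "g \<in> carrier G" "x \<in> set T" "z = \<alpha> (g \<otimes> x [^] j \<otimes> inv g)"
      by (auto simp: stabilizer_set_def)
    then have "z = \<alpha> g \<otimes> \<alpha> x [^] j \<otimes> inv (\<alpha> g)"
      using T pow by auto
    moreover have "\<alpha> g \<in> carrier G" "\<alpha> x \<in> set (map \<alpha> T)"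
      using z by auto
    ultimately show "z \<in> stabilizer_set G (map \<alpha> T)"
      unfolding stabilizer_set_def by blast
  qed
  have "ord (\<alpha> x) = ord x" if x: "x \<in> carrier G" for x
  proof -
    have "\<alpha> x [^] n = \<one> \<longleftrightarrow> x [^] n = \<one>" for n :: nat
      using bij x \<alpha>.hom_one \<alpha>.hom_nat_pow[OF x]
      by (metis bij_betw_def inj_onD nat_pow_closed one_closed)
    then show ?thesis
      using x by (simp add: ord_unique pow_eq_id)
  qed
  then show "map ord (map \<alpha> T) = map ord T"
    using T by auto
qed

text \<open>So the orbits counted by \<^const>\<open>num_components\<close> are those of a group action, and no
  generator is discarded by \<^const>\<open>subgroup_generated\<close>.\<close>

lemma hurwitz_moves_permute:
  fixes k m :: nat
  assumes fin: "finite (carrier G)"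
  defines "U \<equiv> unmixed_structures G (replicate k m) (replicate k m)"
  shows "hurwitz_moves G k U \<subseteq> carrier (BijGroup U)"
proof -
  have len: "length T = k" if "has_type G T (replicate k m)" for T
    using that unfolding has_type_def by (metis length_map length_replicate)
  have UD: "set S \<subseteq> carrier G" "set T \<subseteq> carrier G" "length S = k" "length T = k"
    if "(S, T) \<in> U" for S T
    using that len by (auto simp: U_def unmixed_structures_def spherical_system_def)
  define L where "L = {T. set T \<subseteq> carrier G \<and> length T = k}"
  have UL: "U \<subseteq> L \<times> L"
    by (intro subrelI) (simp add: UD L_def)
  then have "finite U"
    unfolding L_def using finite_lists_length_eq[OF fin] by (meson finite_SigmaI finite_subset)
  have inj: "inj_on (\<lambda>(S, T). (f S, g T)) U" if "inj_on f L" "inj_on g L"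
    for f g :: "'a list \<Rightarrow> 'a list"
    using inj_on_subset[OF map_prod_inj_on[OF that] UL] by (simp add: map_prod_def)
  have inj_id: "inj_on (\<lambda>T. T) L"
    by simp
  have inj_braid: "inj_on (braid_move G i) L" if "Suc i < k" for i
    using that by (auto simp: L_def intro!: inj_onI braid_move_inj[where i = i])
  have BijI: "restrict f U \<in> Bij U" if "\<And>z. z \<in> U \<Longrightarrow> f z \<in> U" "inj_on f U" for f
  proof -
    have "bij_betw f U U"
      unfolding bij_betw_def using that \<open>finite U\<close> by (auto simp: endo_inj_surj image_subsetI)
    then show ?thesis
      by (simp add: Bij_def cong: bij_betw_cong)
  qed
  have braid: "spherical_system G (braid_move G i T) \<and>
      has_type G (braid_move G i T) (replicate k m) \<and>
      stabilizer_set G (braid_move G i T) = stabilizer_set G T"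
    if T: "spherical_system G T" "has_type G T (replicate k m)" and "Suc i < k" for i T
    using braid_move_system[of T i] braid_move_type[of T i k m] that len[OF T(2)]
    by (auto simp: spherical_system_def braid_move_def)
  have 1: "(\<lambda>(S, T) \<in> U. (braid_move G i S, T)) \<in> Bij U" if "Suc i < k" for i
  proof (rule BijI)
    show "(\<lambda>(S, T). (braid_move G i S, T)) z \<in> U" if "z \<in> U" for z
      using that braid[OF _ _ \<open>Suc i < k\<close>]
      by (auto simp: U_def unmixed_structures_def disjoint_systems_def)
    show "inj_on (\<lambda>(S, T). (braid_move G i S, T)) U"
      by (rule inj[OF inj_braid[OF that] inj_id])
  qed
  have 2: "(\<lambda>(S, T) \<in> U. (S, braid_move G i T)) \<in> Bij U" if "Suc i < k" for i
  proof (rule BijI)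
    show "(\<lambda>(S, T). (S, braid_move G i T)) z \<in> U" if "z \<in> U" for z
      using that braid[OF _ _ \<open>Suc i < k\<close>]
      by (auto simp: U_def unmixed_structures_def disjoint_systems_def)
    show "inj_on (\<lambda>(S, T). (S, braid_move G i T)) U"
      by (rule inj[OF inj_id inj_braid[OF that]])
  qed
  have 3: "(\<lambda>(S, T) \<in> U. (T, S)) \<in> Bij U"
    by (rule BijI)
      (auto simp: U_def unmixed_structures_def disjoint_systems_def Int_commute inj_on_def)
  have 4: "(\<lambda>(S, T) \<in> U. (map \<alpha> S, map \<alpha> T)) \<in> Bij U" if \<alpha>: "\<alpha> \<in> auto G" for \<alpha>
  proof (rule BijI)
    have bij: "bij_betw \<alpha> (carrier G) (carrier G)" and hom: "\<alpha> \<in> hom G G"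
      using \<alpha> by (auto simp: auto_def Bij_def)
    have one: "\<alpha> \<one> = \<one>"
      using hom by (simp add: hom_one is_group)
    show "(\<lambda>(S, T). (map \<alpha> S, map \<alpha> T)) z \<in> U" if "z \<in> U" for z
    proof -
      obtain S T where z: "z = (S, T)" by (cases z)
      have ST: "set S \<subseteq> carrier G" "set T \<subseteq> carrier G"
        using UD that z by auto
      have stab: "stabilizer_set G X \<subseteq> carrier G" if "set X \<subseteq> carrier G" for X
        using that by (auto simp: stabilizer_set_def subset_iff)
      have "stabilizer_set G (map \<alpha> S) \<inter> stabilizer_set G (map \<alpha> T) =
          \<alpha> ` (stabilizer_set G S \<inter> stabilizer_set G T)"
        using auto_system(4)[OF \<alpha>] ST stab bij
        by (metis bij_betw_def inj_on_image_Int)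
      then show ?thesis
        using that z ST auto_system[OF \<alpha> ST(1)] auto_system[OF \<alpha> ST(2)] bij one
        by (auto simp: U_def unmixed_structures_def disjoint_systems_def spherical_system_def
            has_type_def bij_betw_def)
    qed
    have "inj_on (map \<alpha>) (lists (carrier G))"
      using bij by (simp add: bij_betw_def inj_on_map_lists)
    then have "inj_on (map \<alpha>) L"
      by (rule inj_on_subset) (auto simp: L_def)
    then show "inj_on (\<lambda>(S, T). (map \<alpha> S, map \<alpha> T)) U"
      using inj by blast
  qed
  show ?thesis
    using 1 2 3 4 by (auto simp: hurwitz_moves_def BijGroup_def)
qed

end

abbreviation elementary_abelian :: "nat \<Rightarrow> nat \<Rightarrow> (nat \<Rightarrow> int) monoid"
  where "elementary_abelian p r \<equiv> product_group {..<r} (\<lambda>_. integer_mod_group p)"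

end

theory Submission
  imports Defs
begin

text \<open>
  Write \<open>G\<close> for the group \<open>(\<int>/p)\<^sup>r\<close>, and let \<open>U\<close> be the set of disjoint pairs of spherical systems
  of \<open>r + 1\<close> generators.  Since \<open>\<chi> = p ^ r * (r - 1 - (r + 1) / p)\<^sup>2 / 4\<close> and \<open>r \<ge> 2\<close>, the Euler
  characteristic has the exact order \<open>p ^ r\<close>, and the claim is that the number of orbits on \<open>U\<close> has
  the exact order \<open>p ^ (r * r)\<close>.

  A spherical system consists of a basis of \<open>G\<close> over the field with \<open>p\<close> elements and the inverse of
  its product.  Any two of them are related by an automorphism
  (\<open>auto_transitive_on_spherical_systems\<close>), so every orbit contains a pair with a prescribed first
  system, and there are at most \<open>p ^ (r * r)\<close> candidates for the second one.  This is the upper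
  bound, \<open>num_components_le\<close>.

  For the lower bound, \<open>num_components_ge\<close>, fix a first system \<open>E\<close>.  In an abelian group the
  braid group acts by permutations of the entries.  So, apart from a number of choices that is
  bounded in terms of \<open>r\<close>, two pairs \<open>(E, T)\<close> and \<open>(E, T')\<close> in one orbit are related by an
  automorphism that is already determined by its effect on \<open>E\<close>: an orbit contains boundedly many
  pairs with first system \<open>E\<close> (\<open>card_structures_le_num_components\<close>).  It remains to see that a
  positive proportion of all \<open>r\<close>-tuples leads to a second system \<open>T\<close> disjoint from \<open>E\<close>
  (\<open>card_spherical_avoiding_ge\<close>).  Choose the entries of \<open>T\<close> one after the other.  Each has to
  avoid a proper subgroup, of order at most \<open>p ^ (r - 1)\<close>, and two sets of \<open>O(p)\<close> elements; as
  \<open>r \<ge> 2\<close>, these are at most half of the elements of \<open>G\<close> when \<open>p\<close> is large.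
\<close>

section \<open>Orbits of generated permutation groups\<close>

lemma group_action_subgroup_generated_BijGroup:
  "group_action (subgroup_generated (BijGroup U) M) U (\<lambda>g. g)"
proof (intro group_action.intro group_hom.intro group_hom_axioms.intro)
  interpret B: group "BijGroup U"
    by (rule group_BijGroup)
  show "group (subgroup_generated (BijGroup U) M)"
    by (rule B.group_subgroup_generated)
  show "group (BijGroup U)"
    by (rule group_BijGroup)
  show "(\<lambda>g. g) \<in> hom (subgroup_generated (BijGroup U) M) (BijGroup U)"
    using B.carrier_subgroup_generated_subset[of M] by (auto simp: hom_def)
qed

lemma (in group_action) orbit_eqI:
  assumes x: "x \<in> E" and y: "y \<in> E" and yx: "y \<in> orbit G \<phi> x"
  shows "orbit G \<phi> x = orbit G \<phi> y"
proof -
  have sub: "orbit G \<phi> z \<subseteq> E" if "z \<in> E" for z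
    using element_image[OF _ that] unfolding orbit_def by blast
  have xy: "x \<in> orbit G \<phi> y"
    by (rule orbit_sym[OF x y yx])
  show ?thesis
    using sub[OF x] sub[OF y] orbit_trans[OF x y _ yx] orbit_trans[OF y x _ xy] by blast
qed

text \<open>
  The generated group also contains the inverses of the generators.  They preserve \<open>W\<close> because an
  injective map of a finite set into itself is onto.
\<close>
lemma generated_permutation_preserves:
  assumes W: "finite W" "W \<subseteq> U"
    and M: "\<And>s w. s \<in> M \<Longrightarrow> w \<in> W \<Longrightarrow> s w \<in> W"
    and g: "g \<in> carrier (subgroup_generated (BijGroup U) M)" and w: "w \<in> W"
  shows "g w \<in> W"
proof -
  have "g \<in> generate (BijGroup U) (carrier (BijGroup U) \<inter> M)"
    using g by (simp add: carrier_subgroup_generated)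
  then have "g \<in> Bij U \<and> g ` W \<subseteq> W"
  proof (induction rule: generate.induct)
    case one
    have "(\<lambda>x\<in>U. x) ` W \<subseteq> W" using W by auto
    then show ?case using id_Bij[of U] by (simp add: BijGroup_def del: restrict_apply)
  next
    case (incl h)
    then show ?case using M by (auto simp: BijGroup_def)
  next
    case (inv h)
    then have h: "h \<in> Bij U" "h ` W \<subseteq> W" using M by (auto simp: BijGroup_def)
    have inj: "inj_on h U" using h by (auto simp: Bij_def bij_betw_def)
    have "h ` W = W"
      using endo_inj_surj[OF W(1) h(2) inj_on_subset[OF inj W(2)]] .
    have "inv_into U h w \<in> W" if w: "w \<in> W" for w
    proof -
      have "w \<in> h ` W" using \<open>h ` W = W\<close> w by simp
      then obtain w' where "w' \<in> W" "w = h w'" by (rule imageE)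
      then show ?thesis using W(2) inj by (simp add: subset_iff)
    qed
    then have "(\<lambda>x\<in>U. inv_into U h x) ` W \<subseteq> W" using W(2) by auto
    then show ?case
      using restrict_inv_into_Bij[OF h(1)] by (simp add: inv_BijGroup[OF h(1)] del: restrict_apply)
  next
    case (eng h1 h2)
    then have h: "h1 \<in> Bij U" "h2 \<in> Bij U" "h1 ` W \<subseteq> W" "h2 ` W \<subseteq> W" by auto
    then have "compose U h1 h2 ` W \<subseteq> W" using W(2) by (auto simp: compose_def)
    then show ?case using h by (simp add: BijGroup_def compose_Bij)
  qed
  then show ?thesis using w by auto
qed

section \<open>Counting tuples chosen one entry at a time\<close>

text \<open>
  The entries are chosen from the end of the list, so that the set excluded for a new head
  \<open>x\<close> depends on the tail already chosen.
\<close>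

primrec avoiding :: "('a list \<Rightarrow> 'a set) \<Rightarrow> 'a list \<Rightarrow> bool" where
  "avoiding bad [] \<longleftrightarrow> True"
| "avoiding bad (x # xs) \<longleftrightarrow> x \<notin> bad xs \<and> avoiding bad xs"

lemma card_avoiding_ge:
  assumes A: "finite A" and bad: "\<And>xs. set xs \<subseteq> A \<Longrightarrow> finite (bad xs) \<and> card (bad xs) \<le> b"
  shows "(card A - b) ^ n \<le> card {xs. set xs \<subseteq> A \<and> length xs = n \<and> avoiding bad xs}"
    (is "_ \<le> card (?L n)")
proof (induction n)
  case 0
  have "?L 0 = {[]}" by auto
  then show ?case by simp
next
  case (Suc n)
  have fin: "finite (?L n)" for n
    by (rule finite_subset[OF _ finite_lists_length_eq[OF A, of n]]) auto
  have "(card A - b) * card (?L n) \<le> (\<Sum>xs\<in>?L n. card (A - bad xs))"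
  proof -
    have "card A - b \<le> card (A - bad xs)" if "xs \<in> ?L n" for xs
      using bad[of xs] that diff_card_le_card_Diff[of "bad xs" A] by fastforce
    then have "(\<Sum>xs\<in>?L n. card A - b) \<le> (\<Sum>xs\<in>?L n. card (A - bad xs))"
      by (rule sum_mono)
    then show ?thesis by (simp add: mult.commute)
  qed
  also have "\<dots> = card (SIGMA xs:?L n. A - bad xs)"
    using fin A by (intro card_SigmaI[symmetric]) auto
  also have "\<dots> \<le> card (?L (Suc n))"
    by (intro card_inj_on_le[of "\<lambda>(xs, x). x # xs"] fin) (auto simp: inj_on_def)
  finally have "(card A - b) * card (?L n) \<le> card (?L (Suc n))" .
  then show ?case
    using mult_le_mono2[OF Suc.IH, of "card A - b"] unfolding power_Suc by (rule order_trans[rotated])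
qed

section \<open>Hurwitz orbits in abelian groups\<close>

lemma unmixed_structures_replicateD:
  assumes "(S, T) \<in> unmixed_structures G (replicate k m) (replicate k m)"
  shows "spherical_system G S" "spherical_system G T" "length S = k" "length T = k"
    and "set S \<subseteq> carrier G" "set T \<subseteq> carrier G"
  using assms unfolding unmixed_structures_def spherical_system_def has_type_def
  by (auto dest!: arg_cong[where f = length])

lemma finite_unmixed_structures_replicate:
  assumes "finite (carrier G)"
  shows "finite (unmixed_structures G (replicate k m) (replicate k m))"
proof (rule finite_subset)
  let ?L = "{T. set T \<subseteq> carrier G \<and> length T = k}"
  show "unmixed_structures G (replicate k m) (replicate k m) \<subseteq> ?L \<times> ?L"
    by (intro subrelI) (simp add: unmixed_structures_replicateD)
  show "finite (?L \<times> ?L)"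
    using finite_lists_length_eq[OF assms] by blast
qed

text \<open>
  A word \<open>w\<close> stands for the rearrangement \<open>map ((!) T) w\<close> of a tuple \<open>T\<close>.  Words with repeated
  letters are allowed: only an upper bound for the number of rearrangements is used, and its
  dependence on \<open>k\<close> alone is what matters.
\<close>

definition index_words :: "nat \<Rightarrow> nat list set"
  where "index_words k = {w. set w \<subseteq> {..<k} \<and> length w = k}"

lemma finite_index_words: "finite (index_words k)"
  and card_index_words: "card (index_words k) = k ^ k"
  using finite_lists_length_eq[of "{..<k}" k] card_lists_length_eq[of "{..<k}" k]
  by (simp_all add: index_words_def)

text \<open>
  In an abelian group this set contains the Hurwitz orbit of \<open>(S, T)\<close>, as the braid group then
  only permutes the entries of a tuple.
\<close>

definition rearrangements ::
    "('a, 'b) monoid_scheme \<Rightarrow> nat \<Rightarrow> 'a list \<Rightarrow> 'a list \<Rightarrow> ('a list \<times> 'a list) set"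
  where "rearrangements G k S T =
    {(map \<alpha> (map ((!) A) v), map \<alpha> (map ((!) B) w)) | \<alpha> A B v w.
      \<alpha> \<in> auto G \<and> (A, B) \<in> {(S, T), (T, S)} \<and> v \<in> index_words k \<and> w \<in> index_words k}"

context group
begin

lemma auto_compose:
  assumes "\<alpha> \<in> auto G" "\<beta> \<in> auto G"
  shows "compose (carrier G) \<alpha> \<beta> \<in> auto G"
  using assms by (auto simp: auto_def Bij_imp_funcset compose_Bij hom_compose)

text \<open>
  An automorphism maps \<open>A\<close> to a tuple that generates, so \<open>A\<close> generates as well, and homomorphisms
  that agree on \<open>A\<close> are equal.
\<close>

lemma auto_map_eq:
  assumes \<alpha>: "\<alpha> \<in> auto G" and \<beta>: "\<beta> \<in> auto G"
    and A: "set A \<subseteq> carrier G" and B: "set B \<subseteq> carrier G"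
    and gen: "generate G (set S) = carrier G"
    and eq: "map \<alpha> A = S" "map \<beta> A = S"
  shows "map \<alpha> B = map \<beta> B"
proof -
  have \<alpha>': "\<alpha> \<in> hom G G" "bij_betw \<alpha> (carrier G) (carrier G)"
    and \<beta>': "\<beta> \<in> hom G G"
    using \<alpha> \<beta> by (auto simp: auto_def Bij_def)
  interpret \<alpha>: group_hom G G \<alpha> using \<alpha>' by unfold_locales
  interpret \<beta>: group_hom G G \<beta> using \<beta>' by unfold_locales
  have "\<alpha> ` generate G (set A) = \<alpha> ` carrier G"
    using auto_system(2)[OF \<alpha> A] eq gen \<alpha>' by (simp add: bij_betw_def)
  then have genA: "generate G (set A) = carrier G"
    using generate_incl[OF A] \<alpha>' by (metis bij_betw_def inj_on_image_eq_iff order_refl)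
  have "\<alpha> x = \<beta> x" if "x \<in> generate G (set A)" for x
    using that
  proof (induction rule: generate.induct)
    case (incl h)
    moreover have "map \<alpha> A = map \<beta> A" using eq by simp
    ultimately show ?case by simp
  next
    case (inv h)
    moreover have "map \<alpha> A = map \<beta> A" using eq by simp
    ultimately have "h \<in> carrier G" "\<alpha> h = \<beta> h" using A by auto
    then show ?case by simp
  next
    case (eng h1 h2)
    then show ?case using genA by auto
  qed auto
  then show ?thesis using B genA by auto
qed

end

context comm_group
begin

text \<open>
  Conjugation is trivial, so a braid move only transposes two adjacent entries.
\<close>

lemma braid_move_comm:
  assumes "set X \<subseteq> carrier G" "Suc i < length X"
  shows "braid_move G i X = X[i := X ! Suc i, Suc i := X ! i]"
proof -
  have "X ! i \<in> carrier G" "X ! Suc i \<in> carrier G"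
    using assms by (auto simp: subset_iff)
  then have "X ! i \<otimes> X ! Suc i \<otimes> inv (X ! i) = X ! Suc i"
    by (metis inv_closed m_assoc m_comm r_inv r_one)
  then show ?thesis by (simp add: braid_move_def)
qed

lemma braid_move_map_index_word:
  assumes A: "set A \<subseteq> carrier G" "length A = k" and \<alpha>: "\<alpha> \<in> auto G"
    and w: "w \<in> index_words k" and i: "Suc i < k"
  shows "\<exists>w'\<in>index_words k. braid_move G i (map \<alpha> (map ((!) A) w)) = map \<alpha> (map ((!) A) w')"
proof
  let ?w = "w[i := w ! Suc i, Suc i := w ! i]"
  have len: "length w = k" and wk: "set w \<subseteq> {..<k}" using w by (auto simp: index_words_def)
  then have "w ! i < k" "w ! Suc i < k"
    using i by (metis Suc_lessD lessThan_iff nth_mem subsetD)+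
  then show "?w \<in> index_words k"
    using w i by (auto simp: index_words_def dest!: set_update_subset_insert[THEN subsetD])
  have "set (map ((!) A) w) \<subseteq> carrier G"
    using A wk by (auto simp: subset_iff)
  then have "set (map \<alpha> (map ((!) A) w)) \<subseteq> carrier G"
    by (rule auto_system(1)[OF \<alpha>])
  then show "braid_move G i (map \<alpha> (map ((!) A) w)) = map \<alpha> (map ((!) A) ?w)"
    using i len by (subst braid_move_comm) (auto simp: map_update)
qed

text \<open>
  The rearrangements of \<open>(S, T)\<close> contain \<open>(S, T)\<close> and are closed under all Hurwitz moves: a braid
  move changes one of the two words, the exchange interchanges the roles of the two tuples, and an
  automorphism is absorbed into the automorphism already present.
\<close>

lemma orbit_subset_rearrangements:
  fixes k m :: nat
  assumes fin: "finite (carrier G)"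
  defines "U \<equiv> unmixed_structures G (replicate k m) (replicate k m)"
  defines "H \<equiv> subgroup_generated (BijGroup U) (hurwitz_moves G k U)"
  assumes ST: "(S, T) \<in> U"
  shows "orbit H (\<lambda>g. g) (S, T) \<subseteq> rearrangements G k S T"
proof -
  note UD = unmixed_structures_replicateD[where k = k and m = m and G = G, folded U_def]
  have AB: "set A \<subseteq> carrier G \<and> length A = k \<and> set B \<subseteq> carrier G \<and> length B = k"
    if "(A, B) \<in> {(S, T), (T, S)}" for A B
    using UD[OF ST] that by auto
  have "finite U"
    unfolding U_def by (rule finite_unmixed_structures_replicate[OF fin])
  define W where "W = U \<inter> rearrangements G k S T"
  have moves_U: "s z \<in> U" if "s \<in> hurwitz_moves G k U" "z \<in> U" for s z
    using hurwitz_moves_permute[OF fin, of k m] that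
    by (auto simp: U_def BijGroup_def dest: Bij_imp_funcset)
  have moves: "s z \<in> rearrangements G k S T"
    if s: "s \<in> hurwitz_moves G k U" and z: "z \<in> W" for s z
  proof -
    obtain \<alpha> A B v w where z': "z = (map \<alpha> (map ((!) A) v), map \<alpha> (map ((!) B) w))"
      and \<alpha>: "\<alpha> \<in> auto G" and AB': "(A, B) \<in> {(S, T), (T, S)}"
      and vw: "v \<in> index_words k" "w \<in> index_words k"
      using z by (auto simp: W_def rearrangements_def)
    note A = AB[OF AB']
    have zU: "z \<in> U" using z by (simp add: W_def)
    from s consider
      (left) i where "Suc i < k" "s = (\<lambda>(S, T) \<in> U. (braid_move G i S, T))"
    | (right) i where "Suc i < k" "s = (\<lambda>(S, T) \<in> U. (S, braid_move G i T))"
    | (swap) "s = (\<lambda>(S, T) \<in> U. (T, S))"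
    | (aut) \<beta> where "\<beta> \<in> auto G" "s = (\<lambda>(S, T) \<in> U. (map \<beta> S, map \<beta> T))"
      by (auto simp: hurwitz_moves_def)
    then show ?thesis
    proof cases
      case left
      obtain u where u: "u \<in> index_words k"
          "braid_move G i (map \<alpha> (map ((!) A) v)) = map \<alpha> (map ((!) A) u)"
        using braid_move_map_index_word[of A k \<alpha> v i] \<alpha> A vw left(1) by blast
      have "s z = (map \<alpha> (map ((!) A) u), map \<alpha> (map ((!) B) w))"
        using left(2) zU u(2) by (simp add: z' del: map_map)
      then show ?thesis
        using u(1) \<alpha> AB' vw unfolding rearrangements_def by blast
    next
      case right
      obtain u where u: "u \<in> index_words k"
          "braid_move G i (map \<alpha> (map ((!) B) w)) = map \<alpha> (map ((!) B) u)"
        using braid_move_map_index_word[of B k \<alpha> w i] \<alpha> A vw right(1) by blast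
      have "s z = (map \<alpha> (map ((!) A) v), map \<alpha> (map ((!) B) u))"
        using right(2) zU u(2) by (simp add: z' del: map_map)
      then show ?thesis
        using u(1) \<alpha> AB' vw unfolding rearrangements_def by blast
    next
      case swap
      then have "s z = (map \<alpha> (map ((!) B) w), map \<alpha> (map ((!) A) v))"
        using zU z' by simp
      moreover have "(B, A) \<in> {(S, T), (T, S)}" using AB' by auto
      ultimately show ?thesis
        using \<alpha> vw unfolding rearrangements_def by blast
    next
      case aut
      let ?\<gamma> = "compose (carrier G) \<beta> \<alpha>"
      have c: "map \<beta> (map \<alpha> (map ((!) C) u)) = map ?\<gamma> (map ((!) C) u)"
        if "u \<in> index_words k" "set C \<subseteq> carrier G" "length C = k" for C u
        using that by (auto simp: index_words_def compose_def subset_iff)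
      have "s z = (map ?\<gamma> (map ((!) A) v), map ?\<gamma> (map ((!) B) w))"
        using zU z' aut c[OF vw(1)] c[OF vw(2)] A by simp
      then show ?thesis
        using auto_compose[OF aut(1) \<alpha>] AB' vw unfolding rearrangements_def by blast
    qed
  qed
  have id: "map (\<lambda>x\<in>carrier G. x) (map ((!) A) [0..<k]) = A"
    if "set A \<subseteq> carrier G" "length A = k" for A
  proof -
    have "map ((!) A) [0..<k] = A" using that map_nth by blast
    then show ?thesis using that by (simp add: map_idI subset_iff)
  qed
  have "[0..<k] \<in> index_words k" by (auto simp: index_words_def)
  then have "(S, T) \<in> rearrangements G k S T"
    using id[of S] id[of T] UD[OF ST] id_in_auto unfolding rearrangements_def by force
  then have W: "(S, T) \<in> W" using ST by (simp add: W_def)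
  have "g (S, T) \<in> W" if "g \<in> carrier H" for g
  proof (rule generated_permutation_preserves[OF _ _ _ _ W])
    show "finite W" "W \<subseteq> U" using \<open>finite U\<close> by (auto simp: W_def)
    show "g \<in> carrier (subgroup_generated (BijGroup U) (hurwitz_moves G k U))"
      using that by (simp add: H_def)
    show "s z \<in> W" if "s \<in> hurwitz_moves G k U" "z \<in> W" for s z
      using moves[OF that] moves_U[OF that(1)] that(2) by (simp add: W_def)
  qed
  then show ?thesis by (auto simp: orbit_def W_def)
qed

text \<open>
  An orbit meets the pairs with a fixed generating first entry \<open>E\<close> in boundedly many points.  Given
  the order of the two tuples (\<open>2\<close> choices) and the two words (\<open>k ^ k\<close> choices each), the
  automorphism must carry a known tuple to \<open>E\<close>, and this determines the image of the other tuple.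
\<close>

lemma card_fibre_rearrangements:
  assumes S: "set S \<subseteq> carrier G" "length S = k" and T: "set T \<subseteq> carrier G" "length T = k"
    and E: "generate G (set E) = carrier G"
  shows "card {T'. (E, T') \<in> rearrangements G k S T} \<le> 2 * (k ^ k)\<^sup>2"
proof -
  define code where "code = {(S, T), (T, S)} \<times> index_words k \<times> index_words k"
  define F where "F = (\<lambda>((A, B), v, w).
    {T'. \<exists>\<alpha>\<in>auto G. E = map \<alpha> (map ((!) A) v) \<and> T' = map \<alpha> (map ((!) B) w)})"
  have fin: "finite code" by (simp add: code_def finite_index_words)
  have card_code: "card code \<le> 2 * (k ^ k)\<^sup>2"
  proof -
    have "card {(S, T), (T, S)} \<le> 2"
      by (rule order_trans[OF card_insert_le_m1]) auto
    then have "card {(S, T), (T, S)} * (k ^ k)\<^sup>2 \<le> 2 * (k ^ k)\<^sup>2"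
      by (rule mult_le_mono1)
    then show ?thesis
      unfolding code_def card_cartesian_product card_index_words power2_eq_square .
  qed
  have one: "finite (F c) \<and> card (F c) \<le> 1" if c: "c \<in> code" for c
  proof -
    obtain A B v w where c': "c = ((A, B), v, w)" by (metis prod.exhaust)
    have car: "set (map ((!) A) v) \<subseteq> carrier G" "set (map ((!) B) w) \<subseteq> carrier G"
      using c S T by (auto simp: c' code_def index_words_def subset_iff)
    have "X = Y" if XY: "X \<in> F c" "Y \<in> F c" for X Y
    proof -
      obtain \<alpha> where \<alpha>: "\<alpha> \<in> auto G" "E = map \<alpha> (map ((!) A) v)" "X = map \<alpha> (map ((!) B) w)"
        using XY(1) unfolding F_def c' prod.case by blast
      obtain \<beta> where \<beta>: "\<beta> \<in> auto G" "E = map \<beta> (map ((!) A) v)" "Y = map \<beta> (map ((!) B) w)"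
        using XY(2) unfolding F_def c' prod.case by blast
      show ?thesis
        unfolding \<alpha>(3) \<beta>(3)
        by (rule auto_map_eq[OF \<alpha>(1) \<beta>(1) car E \<alpha>(2)[symmetric] \<beta>(2)[symmetric]])
    qed
    then have "F c = {} \<or> (\<exists>X. F c = {X})" by blast
    then show ?thesis by (elim disjE exE) auto
  qed
  have "{T'. (E, T') \<in> rearrangements G k S T} \<subseteq> (\<Union>c\<in>code. F c)"
  proof
    fix T' assume "T' \<in> {T'. (E, T') \<in> rearrangements G k S T}"
    then obtain \<alpha> A B v w where "E = map \<alpha> (map ((!) A) v)" "T' = map \<alpha> (map ((!) B) w)"
      "\<alpha> \<in> auto G" "((A, B), v, w) \<in> code"
      by (auto simp: rearrangements_def code_def)
    then have "T' \<in> F ((A, B), v, w)" by (auto simp: F_def)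
    with \<open>((A, B), v, w) \<in> code\<close> show "T' \<in> (\<Union>c\<in>code. F c)" by blast
  qed
  then have "card {T'. (E, T') \<in> rearrangements G k S T} \<le> card (\<Union>c\<in>code. F c)"
    using one fin by (intro card_mono) auto
  also have "\<dots> \<le> (\<Sum>c\<in>code. card (F c))"
    by (rule card_UN_le[OF fin])
  also have "\<dots> \<le> (\<Sum>c\<in>code. 1)"
    using one by (intro sum_mono) auto
  finally show ?thesis using card_code by simp
qed

text \<open>
  The orbits cover the structures with first entry \<open>E\<close>, and each contains at most
  \<open>2 * (k ^ k)\<^sup>2\<close> of them.
\<close>

lemma card_structures_le_num_components:
  fixes k m :: nat
  assumes fin: "finite (carrier G)" and E: "generate G (set E) = carrier G"
  defines "U \<equiv> unmixed_structures G (replicate k m) (replicate k m)"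
  shows "card {T. (E, T) \<in> U} \<le> num_components G k m * (2 * (k ^ k)\<^sup>2)"
proof -
  define H where "H = subgroup_generated (BijGroup U) (hurwitz_moves G k U)"
  define Os where "Os = orbits H U (\<lambda>g. g)"
  interpret H: group_action H U "\<lambda>g. g"
    unfolding H_def by (rule group_action_subgroup_generated_BijGroup)
  note UD = unmixed_structures_replicateD[where k = k and m = m and G = G, folded U_def]
  define L where "L = {T. set T \<subseteq> carrier G \<and> length T = k}"
  have finL: "finite L" unfolding L_def using finite_lists_length_eq[OF fin] .
  have "finite U"
    unfolding U_def by (rule finite_unmixed_structures_replicate[OF fin])
  moreover have "Os = orbit H (\<lambda>g. g) ` U" unfolding Os_def orbits_def by blast
  ultimately have finOs: "finite Os" by simp
  have fibre: "card {T. (E, T) \<in> Q} \<le> 2 * (k ^ k)\<^sup>2 \<and> finite {T. (E, T) \<in> Q}" if Q: "Q \<in> Os" for Q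
  proof -
    obtain z where z: "z \<in> U" "Q = orbit H (\<lambda>g. g) z"
      using Q unfolding Os_def orbits_def by blast
    obtain S T where "z = (S, T)" by (cases z)
    with z have ST: "(S, T) \<in> U" "Q = orbit H (\<lambda>g. g) (S, T)" by simp_all
    have sub: "Q \<subseteq> rearrangements G k S T"
      using orbit_subset_rearrangements[OF fin, of S T k m] ST by (simp add: H_def U_def)
    have OL: "{X. (E, X) \<in> rearrangements G k S T} \<subseteq> L"
    proof (rule subsetI)
      fix X assume "X \<in> {X. (E, X) \<in> rearrangements G k S T}"
      then obtain \<alpha> B w where X: "X = map \<alpha> (map ((!) B) w)" and \<alpha>: "\<alpha> \<in> auto G"
        and B: "B \<in> {S, T}" and w: "w \<in> index_words k"
        unfolding rearrangements_def by blast
      have "set (map ((!) B) w) \<subseteq> carrier G"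
        using UD[OF ST(1)] B w by (auto simp: index_words_def subset_iff)
      then have "set X \<subseteq> carrier G"
        unfolding X by (rule auto_system(1)[OF \<alpha>])
      moreover have "length X = k"
        using w by (simp add: X index_words_def)
      ultimately show "X \<in> L"
        by (simp add: L_def)
    qed
    have "card {T. (E, T) \<in> Q} \<le> card {T'. (E, T') \<in> rearrangements G k S T}"
      using sub finite_subset[OF OL finL] by (intro card_mono) auto
    also have "\<dots> \<le> 2 * (k ^ k)\<^sup>2"
      using UD[OF ST(1)] E by (intro card_fibre_rearrangements) auto
    finally have "card {T. (E, T) \<in> Q} \<le> 2 * (k ^ k)\<^sup>2" .
    moreover have "{T. (E, T) \<in> Q} \<subseteq> L" using sub OL by blast
    ultimately show ?thesis using finL by (blast intro: finite_subset)
  qed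
  have "{T. (E, T) \<in> U} \<subseteq> (\<Union>Q\<in>Os. {T. (E, T) \<in> Q})"
  proof
    fix T assume "T \<in> {T. (E, T) \<in> U}"
    then have "orbit H (\<lambda>g. g) (E, T) \<in> Os" "(E, T) \<in> orbit H (\<lambda>g. g) (E, T)"
      using H.orbit_refl by (auto simp: Os_def orbits_def)
    then show "T \<in> (\<Union>Q\<in>Os. {T. (E, T) \<in> Q})" by blast
  qed
  then have "card {T. (E, T) \<in> U} \<le> card (\<Union>Q\<in>Os. {T. (E, T) \<in> Q})"
    using fibre finOs by (intro card_mono) auto
  also have "\<dots> \<le> (\<Sum>Q\<in>Os. card {T. (E, T) \<in> Q})"
    by (rule card_UN_le[OF finOs])
  also have "\<dots> \<le> (\<Sum>Q\<in>Os. 2 * (k ^ k)\<^sup>2)"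
    using fibre by (intro sum_mono) auto
  finally show ?thesis
    by (simp add: num_components_def Let_def Os_def H_def U_def)
qed

end

section \<open>Systems of generators of elementary abelian groups\<close>

lemma (in group) prod_tuple_closed:
  "set T \<subseteq> carrier G \<Longrightarrow> prod_tuple G T \<in> carrier G"
  by (induction T) (auto simp: prod_tuple_def)

lemma prod_tuple_Cons: "prod_tuple G (x # T) = x \<otimes>\<^bsub>G\<^esub> prod_tuple G T"
  by (simp add: prod_tuple_def)

lemma (in comm_group) stabilizer_set_comm:
  assumes "set T \<subseteq> carrier G"
  shows "stabilizer_set G T = {x [^] (j :: nat) | x j. x \<in> set T}"
proof -
  have c: "g \<otimes> x [^] j \<otimes> inv g = x [^] j"
    if "g \<in> carrier G" "x \<in> set T" for g x and j :: nat
  proof -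
    have x: "x [^] j \<in> carrier G" using that assms by auto
    then have "g \<otimes> x [^] j \<otimes> inv g = x [^] j \<otimes> (g \<otimes> inv g)"
      using that(1) by (simp add: m_comm[of g] m_assoc)
    then show ?thesis using that(1) x by simp
  qed
  show ?thesis
    unfolding stabilizer_set_def
  proof (intro equalityI subsetI)
    fix z assume "z \<in> {x [^] (j :: nat) | x j. x \<in> set T}"
    then obtain x and j :: nat where x: "x \<in> set T" "z = x [^] j" by blast
    have "z = \<one> \<otimes> x [^] j \<otimes> inv \<one>"
      unfolding x(2) by (rule c[OF one_closed x(1), symmetric])
    then show "z \<in> {g \<otimes> x [^] j \<otimes> inv g | g x (j :: nat). g \<in> carrier G \<and> x \<in> set T}"
      using x(1) one_closed by blast
  next
    fix z assume "z \<in> {g \<otimes> x [^] j \<otimes> inv g | g x (j :: nat). g \<in> carrier G \<and> x \<in> set T}"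
    then obtain g x and j :: nat where g: "g \<in> carrier G" "x \<in> set T" "z = g \<otimes> x [^] j \<otimes> inv g"
      by blast
    have "z = x [^] j"
      unfolding g(3) by (rule c[OF g(1,2)])
    then show "z \<in> {x [^] (j :: nat) | x j. x \<in> set T}"
      using g(2) by blast
  qed
qed

lemma (in comm_group) one_in_stabilizer_set:
  assumes T: "set T \<subseteq> carrier G" "T \<noteq> []"
  shows "\<one> \<in> stabilizer_set G T"
proof -
  have "hd T \<in> set T" using T(2) by simp
  then have "hd T [^] (0 :: nat) \<in> stabilizer_set G T"
    unfolding stabilizer_set_comm[OF T(1)] by blast
  then show ?thesis by simp
qed

locale elementary_abelian_group = comm_group G for G (structure) +
  fixes p r :: nat
  assumes prime: "prime p"
    and exponent: "x \<in> carrier G \<Longrightarrow> x [^] p = \<one>"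
    and order_eq: "order G = p ^ r"
begin

lemma finite_carrier: "finite (carrier G)"
  using order_eq prime order_gt_0_iff_finite by (simp add: prime_gt_0_nat)

lemma ord_eq_prime:
  assumes "x \<in> carrier G" "x \<noteq> \<one>"
  shows "ord x = p"
proof -
  have "ord x dvd p" using assms(1) exponent pow_eq_id by blast
  moreover have "ord x \<noteq> 1" using assms ord_eq_1 by blast
  ultimately show ?thesis using prime by (metis prime_nat_iff)
qed

lemma pow_mod_exponent:
  assumes "x \<in> carrier G"
  shows "x [^] (j mod p) = x [^] j"
proof -
  have "x [^] j = x [^] (p * (j div p) + j mod p)" by simp
  also have "\<dots> = (x [^] p) [^] (j div p) \<otimes> x [^] (j mod p)"
    using assms by (simp add: nat_pow_mult nat_pow_pow del: mult_div_mod_eq)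
  also have "\<dots> = x [^] (j mod p)"
    using assms exponent by simp
  finally show ?thesis by simp
qed

lemma card_stabilizer_set_le:
  assumes T: "set T \<subseteq> carrier G"
  shows "card (stabilizer_set G T) \<le> length T * p"
proof -
  have "stabilizer_set G T \<subseteq> (\<lambda>(x, j). x [^] j) ` (set T \<times> {..<p})"
  proof
    fix z assume "z \<in> stabilizer_set G T"
    then obtain x and j :: nat where x: "x \<in> set T" "z = x [^] j"
      by (auto simp: stabilizer_set_comm[OF T])
    then have "z = x [^] (j mod p)" using T pow_mod_exponent by auto
    then show "z \<in> (\<lambda>(x, j). x [^] j) ` (set T \<times> {..<p})"
      using x(1) prime by (auto simp: prime_gt_0_nat)
  qed
  then have "card (stabilizer_set G T) \<le> card (set T \<times> {..<p})"
    by (intro surj_card_le) auto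
  also have "\<dots> \<le> length T * p"
    by (simp add: card_cartesian_product card_length)
  finally show ?thesis .
qed

text \<open>
  Every nontrivial power of an element of order \<open>p\<close> generates the same subgroup as the element.  So
  if a nontrivial power of an entry \<open>y\<close> of \<open>T\<close> were a power of an entry of \<open>S\<close>, then \<open>y\<close> itself
  would be one.
\<close>

lemma disjoint_systems_if_avoiding:
  assumes S: "set S \<subseteq> carrier G" "S \<noteq> []" and T: "set T \<subseteq> carrier G" "T \<noteq> []"
    and avoid: "set T \<inter> stabilizer_set G S = {}"
  shows "disjoint_systems G S T"
proof -
  have "z = \<one>" if z: "z \<in> stabilizer_set G S" "z \<in> stabilizer_set G T" for z
  proof (rule ccontr)
    assume nz: "z \<noteq> \<one>"
    obtain y and j :: nat where y: "y \<in> set T" "z = y [^] j"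
      using z(2) unfolding stabilizer_set_comm[OF T(1)] by blast
    obtain x and i :: nat where x: "x \<in> set S" "z = x [^] i"
      using z(1) unfolding stabilizer_set_comm[OF S(1)] by blast
    have yG: "y \<in> carrier G" and xG: "x \<in> carrier G" using y x T S by auto
    have "\<not> p dvd j"
      using nz y yG exponent by (metis dvdE nat_pow_one nat_pow_pow)
    then obtain n k where nk: "j * n = Suc (p * k)"
      using bezout_prime[OF prime] by blast
    have "x [^] (i * n) = z [^] n"
      using x xG by (simp add: nat_pow_pow)
    also have "\<dots> = y [^] (j * n)"
      using y yG by (simp add: nat_pow_pow)
    also have "\<dots> = (y [^] p) [^] k \<otimes> y"
      unfolding nk using yG by (simp add: nat_pow_pow)
    also have "\<dots> = y"
      using yG exponent by simp
    finally have "y = x [^] (i * n)" by simp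
    then have "y \<in> stabilizer_set G S"
      using x by (auto simp: stabilizer_set_comm[OF S(1)])
    then show False using avoid y by blast
  qed
  then show ?thesis
    using one_in_stabilizer_set[OF S] one_in_stabilizer_set[OF T] unfolding disjoint_systems_def by blast
qed

lemma card_subgroup_power:
  assumes "subgroup H G"
  obtains j where "card H = p ^ j" "j \<le> r"
proof -
  have "card H dvd p ^ r"
    using lagrange[OF assms] order_eq by (metis dvd_triv_right)
  then show ?thesis
    using that divides_primepow_nat[OF prime] by blast
qed

lemma card_proper_subgroup_le:
  assumes "subgroup H G" "H \<noteq> carrier G"
  shows "card H \<le> p ^ (r - 1)"
proof -
  obtain j where j: "card H = p ^ j" "j \<le> r"
    using card_subgroup_power[OF assms(1)] .
  have "j \<noteq> r"
    using assms j order_eq card_subset_eq[OF finite_carrier] subgroup.subset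
    by (metis order_def)
  then have "j \<le> r - 1" using j by simp
  moreover have "1 \<le> p" using prime_ge_1_nat[OF prime] .
  ultimately show ?thesis
    unfolding j(1) by (rule power_increasing)
qed

text \<open>
  The elements excluded when the list \<open>xs\<close> is extended: those that do not enlarge the generated
  subgroup, as long as it is proper, the elements of \<open>L\<close>, and those for which the entry that would
  complete the list to a tuple with product \<open>\<one>\<close> lies in \<open>L\<close>.  Imposing the last condition at
  every choice, and not just at the final one, gives all choices the same form.
\<close>

definition greedy_bad :: "'a set \<Rightarrow> 'a list \<Rightarrow> 'a set" where
  "greedy_bad L xs =
    (if generate G (set xs) = carrier G then {} else generate G (set xs)) \<union> L \<union>
    {x \<in> carrier G. inv (x \<otimes> prod_tuple G xs) \<in> L}"

lemma card_greedy_bad: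
  assumes L: "L \<subseteq> carrier G" and xs: "set xs \<subseteq> carrier G"
  shows "finite (greedy_bad L xs) \<and> card (greedy_bad L xs) \<le> p ^ (r - 1) + 2 * card L"
proof -
  let ?A = "if generate G (set xs) = carrier G then {} else generate G (set xs)"
  let ?C = "{x \<in> carrier G. inv (x \<otimes> prod_tuple G xs) \<in> L}"
  have finL: "finite L" using L finite_carrier finite_subset by blast
  have "card ?A \<le> p ^ (r - 1)"
    using card_proper_subgroup_le[OF generate_is_subgroup[OF xs]] by simp
  moreover have "inj_on (\<lambda>x. inv (x \<otimes> prod_tuple G xs)) ?C"
  proof (rule inj_onI)
    fix x y assume "x \<in> ?C" "y \<in> ?C" and eq: "inv (x \<otimes> prod_tuple G xs) = inv (y \<otimes> prod_tuple G xs)"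
    then have xy: "x \<in> carrier G" "y \<in> carrier G" by blast+
    note P = prod_tuple_closed[OF xs]
    have "inv (inv (x \<otimes> prod_tuple G xs)) = inv (inv (y \<otimes> prod_tuple G xs))"
      by (simp only: eq)
    then have "x \<otimes> prod_tuple G xs = y \<otimes> prod_tuple G xs"
      using xy P by simp
    then show "x = y"
      using xy P by simp
  qed
  then have "card ?C \<le> card L"
    by (intro card_inj_on_le finL) auto
  moreover have "card (greedy_bad L xs) \<le> card ?A + card L + card ?C"
    unfolding greedy_bad_def
    by (rule order_trans[OF card_Un_le]) (intro add_right_mono card_Un_le)
  moreover have "finite (greedy_bad L xs)"
    using finL finite_carrier generate_incl[OF xs]
    by (auto simp: greedy_bad_def intro: finite_subset)
  ultimately show ?thesis by linarith
qed

text \<open>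
  The generated subgroups have \<open>p\<close>-power order, so each choice multiplies the order by at least \<open>p\<close>
  until the whole group is reached.  This takes at most \<open>r\<close> choices.
\<close>

lemma greedy_generates:
  assumes "set xs \<subseteq> carrier G" "avoiding (greedy_bad L) xs" "r \<le> length xs"
  shows "generate G (set xs) = carrier G"
proof -
  have "generate G (set xs) = carrier G \<or> p ^ length xs \<le> card (generate G (set xs))"
    using assms(1,2)
  proof (induction xs)
    case Nil
    then show ?case by (simp add: generate_empty)
  next
    case (Cons x xs)
    let ?H = "generate G (set xs)" and ?K = "generate G (set (x # xs))"
    have x: "x \<in> carrier G" and xs: "set xs \<subseteq> carrier G" and xxs: "set (x # xs) \<subseteq> carrier G"
      using Cons.prems by auto
    have HK: "?H \<subseteq> ?K" and KG: "?K \<subseteq> carrier G"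
      by (intro mono_generate) (use generate_incl[OF xxs] in auto)
    show ?case
    proof (cases "?H = carrier G")
      case True
      then show ?thesis using HK KG by auto
    next
      case False
      then have "x \<notin> ?H" and IH: "p ^ length xs \<le> card ?H"
        using Cons by (auto simp: greedy_bad_def)
      moreover have "x \<in> ?K" by (simp add: generate.incl)
      ultimately have "?H \<subset> ?K" using HK by blast
      then have less: "card ?H < card ?K"
        using KG finite_carrier by (meson finite_subset psubset_card_mono)
      obtain i j where ij: "card ?H = p ^ i" "card ?K = p ^ j"
        using card_subgroup_power generate_is_subgroup[OF xs] generate_is_subgroup[OF xxs] by metis
      have p: "1 < p" using prime by (rule prime_gt_1_nat)
      have "length xs \<le> i" "i < j"
        using IH less p unfolding ij by (simp_all add: power_increasing_iff power_strict_increasing_iff)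
      then have "p ^ length (x # xs) \<le> p ^ j"
        using p by (intro power_increasing) auto
      then show ?thesis using ij(2) by metis
    qed
  qed
  moreover have "generate G (set xs) = carrier G" if "p ^ length xs \<le> card (generate G (set xs))"
  proof (rule card_seteq[OF finite_carrier generate_incl[OF assms(1)]])
    have "card (carrier G) \<le> p ^ length xs"
      unfolding order_eq[unfolded order_def]
      by (rule power_increasing[OF assms(3) prime_ge_1_nat[OF prime]])
    then show "card (carrier G) \<le> card (generate G (set xs))" using that by linarith
  qed
  ultimately show ?thesis by blast
qed

lemma avoiding_greedy_bad_disjoint:
  "avoiding (greedy_bad L) xs \<Longrightarrow> set xs \<inter> L = {}"
  by (induction xs) (auto simp: greedy_bad_def)

definition spherical_avoiding :: "'a set \<Rightarrow> 'a list set" where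
  "spherical_avoiding L =
    {T. spherical_system G T \<and> has_type G T (replicate (Suc r) p) \<and> set T \<inter> L = {}}"

text \<open>
  A list of \<open>r\<close> admissible choices is completed by the inverse of its product.  No entry lies in
  \<open>L\<close>; as \<open>\<one> \<in> L\<close>, all entries have order \<open>p\<close>.
\<close>

lemma card_spherical_avoiding_ge:
  assumes r: "2 \<le> r" and L: "L \<subseteq> carrier G" "\<one> \<in> L"
  shows "(p ^ r - (p ^ (r - 1) + 2 * card L)) ^ r \<le> card (spherical_avoiding L)"
proof -
  let ?X = "{xs. set xs \<subseteq> carrier G \<and> length xs = r \<and> avoiding (greedy_bad L) xs}"
  let ?f = "\<lambda>xs. inv (prod_tuple G xs) # xs"
  have "(p ^ r - (p ^ (r - 1) + 2 * card L)) ^ r \<le> card ?X"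
    using card_avoiding_ge[OF finite_carrier card_greedy_bad[OF L(1)], where n = r] order_eq
    by (simp add: order_def)
  also have "\<dots> \<le> card (spherical_avoiding L)"
  proof (rule card_inj_on_le[of ?f])
    show "inj_on ?f ?X" by (auto simp: inj_on_def)
    have "T \<in> {T. set T \<subseteq> carrier G \<and> length T = Suc r}" if "T \<in> spherical_avoiding L" for T
      using that
      by (auto simp: spherical_avoiding_def spherical_system_def has_type_def
          dest!: arg_cong[where f = length])
    then show "finite (spherical_avoiding L)"
      using finite_lists_length_eq[OF finite_carrier, of "Suc r"] by (meson finite_subset subsetI)
    show "?f ` ?X \<subseteq> spherical_avoiding L"
    proof (rule image_subsetI)
      fix xs assume "xs \<in> ?X"
      then have xs: "set xs \<subseteq> carrier G" "length xs = r" "avoiding (greedy_bad L) xs" by auto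
      have P: "prod_tuple G xs \<in> carrier G" using prod_tuple_closed[OF xs(1)] .
      have T: "set (?f xs) \<subseteq> carrier G" using xs P by auto
      have "generate G (set xs) \<subseteq> generate G (set (?f xs))"
        by (intro mono_generate) auto
      then have gen: "generate G (set (?f xs)) = carrier G"
        using greedy_generates[OF xs(1,3)] xs(2) generate_incl[OF T] by auto
      obtain y ys where "xs = y # ys" using xs(2) r by (cases xs) auto
      then have "inv (prod_tuple G xs) \<notin> L"
        using xs by (auto simp: greedy_bad_def prod_tuple_Cons)
      then have avoid: "set (?f xs) \<inter> L = {}"
        using avoiding_greedy_bad_disjoint[OF xs(3)] by auto
      then have "ord x = p" if "x \<in> set (?f xs)" for x
        using that T L by (intro ord_eq_prime) auto
      then have "has_type G (?f xs) (replicate (Suc r) p)"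
        unfolding has_type_def using xs(2) by (intro replicate_eqI) auto
      moreover have "spherical_system G (?f xs)"
        unfolding spherical_system_def using T gen P xs(2) r by (simp add: prod_tuple_Cons)
      ultimately show "?f xs \<in> spherical_avoiding L"
        using avoid by (simp add: spherical_avoiding_def)
    qed
  qed
  finally show ?thesis .
qed

end

section \<open>Transitivity of the automorphism group\<close>

context elementary_abelian_group
begin

abbreviation coords :: "(nat \<Rightarrow> int) monoid" where
  "coords \<equiv> elementary_abelian p r"

definition combination :: "'a list \<Rightarrow> (nat \<Rightarrow> int) \<Rightarrow> 'a" where
  "combination X c = (\<Otimes>i\<in>{..<r}. X ! i [^] c i)"

lemma p_pos: "0 < p"
  using prime by (rule prime_gt_0_nat)

lemma group_coords: "group coords"
  by simp

lemma carrier_coords: "carrier coords = {..<r} \<rightarrow>\<^sub>E {0..<int p}"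
  using p_pos by (simp add: carrier_integer_mod_group)

lemma card_coords: "card (carrier coords) = p ^ r"
  unfolding carrier_coords by (simp add: card_PiE)

lemma int_pow_mod_exponent:
  assumes x: "x \<in> carrier G"
  shows "x [^] (k mod int p) = x [^] (k :: int)"
proof -
  have "x [^] k = x [^] (int p * (k div int p) + k mod int p)" by simp
  also have "\<dots> = (x [^] int p) [^] (k div int p) \<otimes> x [^] (k mod int p)"
    using x by (simp only: int_pow_mult int_pow_pow int_pow_closed)
  also have "\<dots> = x [^] (k mod int p)"
    using x exponent[OF x] by (simp add: int_pow_int)
  finally show ?thesis by simp
qed

text \<open>
  A generating \<open>r\<close>-tuple is a basis over the field with \<open>p\<close> elements: the map from coordinate
  vectors to linear combinations is onto, hence bijective because both sides have \<open>p ^ r\<close> elements.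
\<close>

lemma combination_iso:
  assumes X: "set X \<subseteq> carrier G" "length X = r" and gen: "generate G (set X) = carrier G"
  shows "combination X \<in> iso coords G"
    and "\<And>i. i < r \<Longrightarrow> combination X (\<lambda>j\<in>{..<r}. if j = i then 1 else 0) = X ! i"
proof -
  have Xi: "X ! i \<in> carrier G" if "i < r" for i
    using that X by auto
  have hom: "combination X \<in> hom coords G"
  proof (rule homI)
    fix c d assume "c \<in> carrier coords" "d \<in> carrier coords"
    show "combination X (c \<otimes>\<^bsub>coords\<^esub> d) = combination X c \<otimes> combination X d"
    proof -
      have "combination X (c \<otimes>\<^bsub>coords\<^esub> d) = (\<Otimes>i\<in>{..<r}. X ! i [^] c i \<otimes> X ! i [^] d i)"
        unfolding combination_def
        using Xi by (intro finprod_cong') (auto simp: int_pow_mod_exponent int_pow_mult)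
      also have "\<dots> = combination X c \<otimes> combination X d"
        unfolding combination_def using Xi by (intro finprod_multf) auto
      finally show ?thesis .
    qed
  qed (use Xi in \<open>auto simp: combination_def\<close>)
  show unit: "combination X (\<lambda>j\<in>{..<r}. if j = i then 1 else 0) = X ! i" if i: "i < r" for i
  proof -
    have "combination X (\<lambda>j\<in>{..<r}. if j = i then 1 else 0)
        = (\<Otimes>j\<in>{..<r}. if i = j then X ! j else \<one>)"
      unfolding combination_def using Xi by (intro finprod_cong') auto
    also have "\<dots> = X ! i"
      using i Xi by (intro finprod_singleton) auto
    finally show ?thesis .
  qed
  interpret h: group_hom coords G "combination X"
    using hom group_coords by (intro group_hom.intro group_hom_axioms.intro) auto
  have "set X \<subseteq> combination X ` carrier coords"
  proof
    fix x assume "x \<in> set X"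
    then obtain i where i: "i < r" "x = X ! i" using X by (auto simp: in_set_conv_nth)
    have "2 \<le> p" using prime by (rule prime_ge_2_nat)
    then have "(\<lambda>j\<in>{..<r}. if j = i then 1 else 0) \<in> carrier coords"
      unfolding carrier_coords by auto
    then show "x \<in> combination X ` carrier coords"
      using unit[OF i(1)] i(2) by (metis image_eqI)
  qed
  then have "carrier G \<subseteq> combination X ` carrier coords"
    using generate_subgroup_incl[OF _ h.img_is_subgroup] gen by metis
  then have surj: "combination X ` carrier coords = carrier G"
    using h.hom_closed by blast
  moreover have "inj_on (combination X) (carrier coords)"
  proof (rule eq_card_imp_inj_on)
    show "finite (carrier coords)" unfolding carrier_coords by (intro finite_PiE) auto
    show "card (combination X ` carrier coords) = card (carrier coords)"
      unfolding surj card_coords using order_eq by (simp add: order_def)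
  qed
  ultimately show "combination X \<in> iso coords G"
    using hom by (simp add: iso_def bij_betw_def)
qed

lemma auto_transitive_on_generators:
  assumes X: "set X \<subseteq> carrier G" "length X = r" "generate G (set X) = carrier G"
    and Y: "set Y \<subseteq> carrier G" "length Y = r" "generate G (set Y) = carrier G"
  obtains \<alpha> where "\<alpha> \<in> auto G" "map \<alpha> X = Y"
proof
  let ?f = "combination X" and ?g = "combination Y"
  let ?h = "inv_into (carrier coords) ?f"
  define \<alpha> where "\<alpha> = restrict (?g \<circ> ?h) (carrier G)"
  have f: "?f \<in> iso coords G" and g: "?g \<in> iso coords G"
    using combination_iso X Y by auto
  have "?h \<in> iso G coords"
    by (rule group.iso_set_sym[OF group_coords f])
  then have "?g \<circ> ?h \<in> iso G G"
    by (rule iso_set_trans[OF _ g])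
  then have hom: "?g \<circ> ?h \<in> hom G G" and bij: "bij_betw (?g \<circ> ?h) (carrier G) (carrier G)"
    by (auto simp: iso_def)
  have "\<alpha> \<in> hom G G"
    using hom by (auto simp: \<alpha>_def hom_def)
  moreover have "\<alpha> \<in> Bij (carrier G)"
    using bij by (simp add: \<alpha>_def Bij_def cong: bij_betw_cong)
  ultimately show "\<alpha> \<in> auto G" by (simp add: auto_def)
  have inj: "inj_on ?f (carrier coords)"
    using f by (simp add: iso_def bij_betw_def)
  have "\<alpha> (X ! i) = Y ! i" if i: "i < r" for i
  proof -
    let ?e = "\<lambda>j\<in>{..<r}. if j = i then 1 else 0 :: int"
    have "2 \<le> p" using prime by (rule prime_ge_2_nat)
    then have e: "?e \<in> carrier coords"
      unfolding carrier_coords by auto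
    have fe: "?f ?e = X ! i" and ge: "?g ?e = Y ! i"
      using combination_iso(2)[OF X i] combination_iso(2)[OF Y i] .
    have "X ! i \<in> carrier G" using X i by auto
    then have "\<alpha> (X ! i) = ?g (?h (?f ?e))"
      unfolding \<alpha>_def fe by simp
    also have "\<dots> = Y ! i"
      using inv_into_f_f[OF inj e] ge by simp
    finally show ?thesis .
  qed
  then show "map \<alpha> X = Y"
    using X Y by (intro nth_equalityI) auto
qed

lemma spherical_system_ConsD:
  assumes S: "spherical_system G (x # xs)"
  shows "generate G (set xs) = carrier G" "x = inv (prod_tuple G xs)"
proof -
  have car: "x \<in> carrier G" "set xs \<subseteq> carrier G"
    and gen: "generate G (set (x # xs)) = carrier G" and prod: "x \<otimes> prod_tuple G xs = \<one>"
    using S by (auto simp: spherical_system_def prod_tuple_Cons)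
  show x: "x = inv (prod_tuple G xs)"
    using inv_equality[OF prod prod_tuple_closed[OF car(2)] car(1)] by simp
  have "prod_tuple G xs \<in> generate G (set xs)"
  proof -
    have "set ys \<subseteq> set xs \<Longrightarrow> prod_tuple G ys \<in> generate G (set xs)" for ys
      by (induction ys) (auto simp: prod_tuple_def intro: generate.one generate.eng generate.incl)
    then show ?thesis by blast
  qed
  then have "x \<in> generate G (set xs)"
    unfolding x by (rule generate_m_inv_closed[OF car(2)])
  then have "set (x # xs) \<subseteq> generate G (set xs)"
    by (auto intro: generate.incl)
  then have "carrier G \<subseteq> generate G (set xs)"
    using generate_subgroup_incl[OF _ generate_is_subgroup[OF car(2)]] gen by metis
  then show "generate G (set xs) = carrier G"
    using generate_incl[OF car(2)] by blast
qed

text \<open>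
  The first entry of a system is the inverse of the product of the others, so it is enough to move
  one basis to another, and the first entries follow.
\<close>

lemma auto_transitive_on_spherical_systems:
  assumes S: "spherical_system G S" "length S = Suc r" and T: "spherical_system G T" "length T = Suc r"
  obtains \<alpha> where "\<alpha> \<in> auto G" "map \<alpha> S = T"
proof -
  obtain x xs where S': "S = x # xs" "length xs = r" using S(2) by (cases S) auto
  obtain y ys where T': "T = y # ys" "length ys = r" using T(2) by (cases T) auto
  have car: "set xs \<subseteq> carrier G" "set ys \<subseteq> carrier G" "x \<in> carrier G"
    using S(1) T(1) by (auto simp: S' T' spherical_system_def)
  note x = spherical_system_ConsD[OF S(1)[unfolded S'(1)]] and y = spherical_system_ConsD[OF T(1)[unfolded T'(1)]]
  obtain \<alpha> where \<alpha>: "\<alpha> \<in> auto G" "map \<alpha> xs = ys"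
    using auto_transitive_on_generators[OF car(1) S'(2) x(1) car(2) T'(2) y(1)] .
  interpret \<alpha>: group_hom G G \<alpha>
    using \<alpha>(1) by unfold_locales (simp add: auto_def)
  have "\<alpha> x = inv (\<alpha> (prod_tuple G xs))"
    unfolding x(2) by (rule \<alpha>.hom_inv[OF prod_tuple_closed[OF car(1)]])
  also have "\<dots> = y"
    using auto_system(3)[OF \<alpha>(1) car(1)] \<alpha>(2) y(2) by simp
  finally have "map \<alpha> S = T" by (simp add: S' T' \<alpha>(2))
  then show ?thesis using that \<alpha>(1) by blast
qed

section \<open>Bounds for the number of components\<close>

text \<open>
  By transitivity every orbit contains a pair whose first tuple is a fixed system \<open>S\<^sub>0\<close>.  Its second
  tuple is determined by its last \<open>r\<close> entries, for which there are \<open>(p ^ r) ^ r\<close> choices.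
\<close>

lemma num_components_le: "num_components G (Suc r) p \<le> p ^ (r * r)"
proof -
  define U where "U = unmixed_structures G (replicate (Suc r) p) (replicate (Suc r) p)"
  define H where "H = subgroup_generated (BijGroup U) (hurwitz_moves G (Suc r) U)"
  define Os where "Os = orbits H U (\<lambda>g. g)"
  interpret H: group_action H U "\<lambda>g. g"
    unfolding H_def by (rule group_action_subgroup_generated_BijGroup)
  note UD = unmixed_structures_replicateD[where k = "Suc r" and m = p and G = G, folded U_def]
  have "card Os \<le> p ^ (r * r)"
  proof (cases "U = {}")
    case True
    then show ?thesis by (simp add: Os_def orbits_def)
  next
    case False
    then obtain S\<^sub>0 T\<^sub>0 where 0: "(S\<^sub>0, T\<^sub>0) \<in> U" by auto
    define Y where "Y = {T. (S\<^sub>0, T) \<in> U}"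
    define Z where "Z = {xs. set xs \<subseteq> carrier G \<and> length xs = r}"
    have Z: "finite Z" "card Z = p ^ (r * r)"
      using finite_lists_length_eq[OF finite_carrier, of r]
        card_lists_length_eq[OF finite_carrier, of r] order_eq
      by (simp_all add: Z_def order_def power_mult)
    have Y: "T = inv (prod_tuple G (tl T)) # tl T \<and> tl T \<in> Z" if "T \<in> Y" for T
    proof -
      have T: "spherical_system G T" "length T = Suc r" using UD that by (auto simp: Y_def)
      then obtain x xs where T': "T = x # xs" by (cases T) auto
      show ?thesis
        using T spherical_system_ConsD(2)[of x xs] by (auto simp: T' Z_def spherical_system_def)
    qed
    have "inj_on tl Y"
      using Y by (metis inj_onI)
    moreover have "tl ` Y \<subseteq> Z" using Y by blast
    ultimately have cardY: "finite Y" "card Y \<le> p ^ (r * r)"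
      using Z by (metis finite_imageD finite_subset, metis card_inj_on_le)
    have "Os \<subseteq> (\<lambda>T. orbit H (\<lambda>g. g) (S\<^sub>0, T)) ` Y"
    proof
      fix Q assume "Q \<in> Os"
      then obtain z where z: "z \<in> U" "Q = orbit H (\<lambda>g. g) z"
        unfolding Os_def orbits_def by blast
      obtain S T where ST: "z = (S, T)" by (cases z)
      obtain \<alpha> where \<alpha>: "\<alpha> \<in> auto G" "map \<alpha> S = S\<^sub>0"
        using auto_transitive_on_spherical_systems UD[OF z(1)[unfolded ST]] UD[OF 0] by metis
      define s where "s = (\<lambda>(S, T) \<in> U. (map \<alpha> S, map \<alpha> T))"
      have s: "s \<in> hurwitz_moves G (Suc r) U"
        using \<alpha>(1) unfolding hurwitz_moves_def s_def by blast
      then have "s \<in> carrier (BijGroup U)"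
        using hurwitz_moves_permute[OF finite_carrier] unfolding U_def by blast
      then have sH: "s \<in> carrier H"
        using s unfolding H_def carrier_subgroup_generated by (intro generate.incl) blast
      have sz: "s z = (S\<^sub>0, map \<alpha> T)"
        using z(1) ST \<alpha>(2) by (simp add: s_def)
      let ?w = "(S\<^sub>0, map \<alpha> T)"
      have w: "?w \<in> U" using H.element_image[OF sH z(1) sz] .
      have wz: "?w \<in> orbit H (\<lambda>g. g) z"
        using sH sz[symmetric] unfolding orbit_def by blast
      have "orbit H (\<lambda>g. g) z = orbit H (\<lambda>g. g) ?w"
        by (rule H.orbit_eqI[OF z(1) w wz])
      then show "Q \<in> (\<lambda>T. orbit H (\<lambda>g. g) (S\<^sub>0, T)) ` Y"
        using z(2) w unfolding Y_def by blast
    qed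
    then have "card Os \<le> card Y"
      by (rule surj_card_le[OF cardY(1)])
    then show ?thesis using cardY(2) by linarith
  qed
  then show ?thesis
    by (simp add: num_components_def Let_def Os_def H_def U_def)
qed

text \<open>
  A system is disjoint from a fixed system \<open>E\<close> if its entries avoid the \<open>r + 1\<close> subgroups of order
  \<open>p\<close> generated by the entries of \<open>E\<close>.  At most \<open>p ^ (r - 1) + 2 * (r + 1) * p\<close> elements are
  excluded at each greedy choice.  Since \<open>r \<ge> 2\<close>, this is at most \<open>(2 * r + 3) * p ^ (r - 1)\<close>,
  hence at most half of the group when \<open>p \<ge> 4 * r + 6\<close>.
\<close>

lemma num_components_ge:
  assumes r: "2 \<le> r" and p: "4 * r + 6 \<le> p"
  shows "p ^ (r * r) \<le> num_components G (Suc r) p * (2 ^ Suc r * (Suc r ^ Suc r)\<^sup>2)"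
proof -
  define U where "U = unmixed_structures G (replicate (Suc r) p) (replicate (Suc r) p)"
  define q where "q = p ^ r - (p ^ (r - 1) + 2 * (Suc r * p))"
  have half: "p ^ r \<le> 2 * q"
  proof -
    define m where "m = p ^ (r - 1)"
    have pm: "p ^ r = p * m" using r unfolding m_def by (cases r) auto
    have "(4 * r + 6) * m \<le> p * m"
      using p by (rule mult_le_mono1)
    then have "4 * (Suc r * m) + 2 * m \<le> p * m"
      by (simp add: algebra_simps)
    moreover have "p ^ 1 \<le> m"
      unfolding m_def using r p_pos by (intro power_increasing) auto
    then have "Suc r * p \<le> Suc r * m"
      by (intro mult_le_mono2) simp
    ultimately show ?thesis unfolding q_def pm m_def[symmetric] by linarith
  qed
  have count: "q ^ r \<le> card (spherical_avoiding L)"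
    if L: "L \<subseteq> carrier G" "\<one> \<in> L" "card L \<le> Suc r * p" for L
  proof -
    have "q \<le> p ^ r - (p ^ (r - 1) + 2 * card L)"
      unfolding q_def using L(3) by (intro diff_le_mono2) simp
    then have "q ^ r \<le> (p ^ r - (p ^ (r - 1) + 2 * card L)) ^ r"
      by (rule power_mono) simp
    also have "\<dots> \<le> card (spherical_avoiding L)"
      by (rule card_spherical_avoiding_ge[OF r L(1,2)])
    finally show ?thesis .
  qed
  \<comment> \<open>With \<open>L = {\<one>}\<close> the count shows that there is a first system at all.\<close>
  have "0 < q" using half p_pos by (metis gr0I mult_0_right not_le zero_less_power)
  then have "0 < q ^ r" by simp
  also have "q ^ r \<le> card (spherical_avoiding {\<one>})"
    using p_pos by (intro count) auto
  finally have "card (spherical_avoiding {\<one>}) \<noteq> 0" by simp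
  then obtain E where E: "E \<in> spherical_avoiding {\<one>}"
    by fastforce
  then have E': "spherical_system G E" "has_type G E (replicate (Suc r) p)"
    by (auto simp: spherical_avoiding_def)
  have lenE: "length E = Suc r"
    using E'(2) by (auto simp: has_type_def dest!: arg_cong[where f = length])
  have carE: "set E \<subseteq> carrier G" and genE: "generate G (set E) = carrier G"
    using E'(1) by (auto simp: spherical_system_def)
  have Ene: "E \<noteq> []" using lenE by auto
  let ?L = "stabilizer_set G E"
  have L: "?L \<subseteq> carrier G"
    using carE by (auto simp: stabilizer_set_comm)
  have "\<one> \<in> ?L"
    by (rule one_in_stabilizer_set[OF carE Ene])
  then have "q ^ r \<le> card (spherical_avoiding ?L)"
    using L card_stabilizer_set_le[OF carE] lenE by (intro count) auto
  also have "\<dots> \<le> card {T. (E, T) \<in> U}"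
  proof (rule card_mono)
    have "{T. (E, T) \<in> U} \<subseteq> {T. set T \<subseteq> carrier G \<and> length T = Suc r}"
      by (auto simp: U_def unmixed_structures_def spherical_system_def has_type_def
          dest!: arg_cong[where f = length])
    then show "finite {T. (E, T) \<in> U}"
      using finite_lists_length_eq[OF finite_carrier] by (rule finite_subset)
    show "spherical_avoiding ?L \<subseteq> {T. (E, T) \<in> U}"
    proof
      fix T assume "T \<in> spherical_avoiding ?L"
      then have T: "spherical_system G T" "has_type G T (replicate (Suc r) p)" "set T \<inter> ?L = {}"
        by (auto simp: spherical_avoiding_def)
      then have "set T \<subseteq> carrier G" "T \<noteq> []" by (auto simp: spherical_system_def)
      then have "disjoint_systems G E T"
        using disjoint_systems_if_avoiding carE Ene T(3) by blast
      moreover have "2 \<le> p" using prime by (rule prime_ge_2_nat)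
      ultimately show "T \<in> {T. (E, T) \<in> U}"
        using T E' by (auto simp: U_def unmixed_structures_def)
    qed
  qed
  also have "\<dots> \<le> num_components G (Suc r) p * (2 * (Suc r ^ Suc r)\<^sup>2)"
    unfolding U_def by (rule card_structures_le_num_components[OF finite_carrier genE])
  finally have *: "q ^ r \<le> num_components G (Suc r) p * (2 * (Suc r ^ Suc r)\<^sup>2)" .
  have "p ^ (r * r) = (p ^ r) ^ r" by (simp add: power_mult)
  also have "\<dots> \<le> (2 * q) ^ r" using half by (rule power_mono) simp
  also have "\<dots> = 2 ^ r * q ^ r" by (rule power_mult_distrib)
  also have "\<dots> \<le> 2 ^ r * (num_components G (Suc r) p * (2 * (Suc r ^ Suc r)\<^sup>2))"
    by (rule mult_le_mono2[OF *])
  finally show ?thesis by (simp only: power_Suc mult.assoc mult.left_commute)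
qed

end

section \<open>The asymptotic order of the number of components\<close>

lemma elementary_abelian_group_elementary_abelian:
  assumes p: "prime p"
  shows "elementary_abelian_group (elementary_abelian p r) p r"
proof -
  have p0: "0 < p" using p by (rule prime_gt_0_nat)
  let ?G = "elementary_abelian p r"
  interpret group ?G by simp
  have comm: "comm_group ?G"
    by (rule group_comm_groupI) (auto simp: add.commute)
  have pow: "x [^]\<^bsub>?G\<^esub> n = (\<lambda>i\<in>{..<r}. (int n * x i) mod int p)" if "x \<in> carrier ?G" for x and n :: nat
  proof (induction n)
    case (Suc n)
    then show ?case
      by (auto simp: fun_eq_iff distrib_right mod_simps add.commute)
  qed (auto simp: fun_eq_iff)
  have "x [^]\<^bsub>?G\<^esub> p = \<one>\<^bsub>?G\<^esub>" if "x \<in> carrier ?G" for x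
    unfolding pow[OF that] by simp
  moreover have "order ?G = p ^ r"
    using p0 by (simp add: order_def carrier_integer_mod_group card_PiE)
  ultimately show ?thesis
    using comm p by (simp add: elementary_abelian_group_def elementary_abelian_group_axioms_def)
qed

lemma euler_char_replicate:
  assumes "elementary_abelian_group G p r"
  shows "euler_char G (replicate (Suc r) p) = real p ^ r * (real r - 1 - real (Suc r) / real p)\<^sup>2 / 4"
proof -
  interpret elementary_abelian_group G p r by fact
  have "(\<Sum>m\<leftarrow>replicate (Suc r) p. 1 - 1 / real m) = real (Suc r) * (1 - 1 / real p)"
    by (simp add: map_replicate_const[symmetric] sum_list_replicate del: replicate_Suc)
  then have "- 2 + (\<Sum>m\<leftarrow>replicate (Suc r) p. 1 - 1 / real m) = real r - 1 - real (Suc r) / real p"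
    by (simp add: right_diff_distrib)
  then show ?thesis
    unfolding euler_char_def order_eq by (simp only: of_nat_power)
qed

theorem theorem1p10:
  fixes r :: nat
  assumes "2 \<le> r"
  shows "(\<lambda>p. real (num_components (elementary_abelian p r) (r + 1) p)) \<in>
    \<Theta>[inf at_top (principal {p. prime p})](\<lambda>p. euler_char (elementary_abelian p r) (replicate (r + 1) p) ^ r)"
proof -
  let ?F = "inf at_top (principal {p :: nat. prime p})"
  let ?h = "\<lambda>p. real (num_components (elementary_abelian p r) (r + 1) p)"
  let ?\<chi> = "\<lambda>p. euler_char (elementary_abelian p r) (replicate (r + 1) p)"
  define K where "K = real (2 ^ Suc r * (Suc r ^ Suc r)\<^sup>2)"
  have bounds: "?h p \<le> 16 ^ r * ?\<chi> p ^ r \<and> ?\<chi> p ^ r \<le> (real r ^ 2) ^ r * K * ?h p \<and> 0 \<le> ?\<chi> p"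
    if p: "prime p" "4 * r + 6 \<le> p" for p
  proof -
    interpret elementary_abelian_group "elementary_abelian p r" p r
      by (rule elementary_abelian_group_elementary_abelian[OF p(1)])
    define d where "d = real r - 1 - real (Suc r) / real p"
    have \<chi>: "?\<chi> p = real p ^ r * d\<^sup>2 / 4"
      using euler_char_replicate[OF elementary_abelian_group_axioms] by (simp add: d_def)
    \<comment> \<open>For \<open>p \<ge> 4 * r + 6\<close>, \<open>d\<close> lies between \<open>1 / 2\<close> and \<open>r\<close>, so \<open>\<chi>\<close> has order \<open>p ^ r\<close>.\<close>
    have "real (Suc r) / real p \<le> 1 / 2"
      using p(2) p_pos by (simp add: field_simps)
    then have d1: "1 / 2 \<le> d" using assms by (simp add: d_def)
    have "0 \<le> real (Suc r) / real p" by simp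
    then have d2: "d \<le> real r" unfolding d_def by linarith
    have "(1 / 2)\<^sup>2 \<le> d\<^sup>2" using d1 by (intro power_mono) auto
    then have "real p ^ r * (1 / 2)\<^sup>2 \<le> real p ^ r * d\<^sup>2"
      by (intro mult_left_mono) auto
    then have lower: "real p ^ r \<le> 16 * ?\<chi> p"
      unfolding \<chi> by (simp add: power2_eq_square mult_ac)
    have "d\<^sup>2 \<le> (real r)\<^sup>2" using d1 d2 by (intro power_mono) auto
    then have "real p ^ r * d\<^sup>2 \<le> real p ^ r * (real r)\<^sup>2"
      by (intro mult_left_mono) auto
    moreover have "0 \<le> real p ^ r * d\<^sup>2" by simp
    ultimately have upper: "?\<chi> p \<le> (real r)\<^sup>2 * real p ^ r"
      unfolding \<chi> mult.commute[of "(real r)\<^sup>2"] by linarith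
    have \<chi>0: "0 \<le> ?\<chi> p" unfolding \<chi> by simp
    have pr: "real (p ^ (r * r)) = (real p ^ r) ^ r"
      by (simp add: power_mult)
    have "?h p \<le> real (p ^ (r * r))"
      using num_components_le by (simp only: of_nat_le_iff Suc_eq_plus1)
    also have "\<dots> \<le> (16 * ?\<chi> p) ^ r"
      unfolding pr by (rule power_mono[OF lower]) simp
    finally have 1: "?h p \<le> 16 ^ r * ?\<chi> p ^ r"
      by (simp only: power_mult_distrib)
    have "?\<chi> p ^ r \<le> ((real r)\<^sup>2 * real p ^ r) ^ r"
      by (rule power_mono[OF upper \<chi>0])
    also have "\<dots> = (real r ^ 2) ^ r * real (p ^ (r * r))"
      unfolding pr by (rule power_mult_distrib)
    also have "real (p ^ (r * r)) \<le> K * ?h p"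
    proof -
      have "real (p ^ (r * r)) \<le> real (num_components (elementary_abelian p r) (Suc r) p
          * (2 ^ Suc r * (Suc r ^ Suc r)\<^sup>2))"
        using num_components_ge[OF assms p(2)] by (simp only: of_nat_le_iff)
      then show ?thesis
        by (simp only: of_nat_mult[of "num_components _ _ _"] K_def Suc_eq_plus1 mult.commute)
    qed
    finally have "?\<chi> p ^ r \<le> (real r ^ 2) ^ r * (K * ?h p)"
      by (simp add: mult_left_mono)
    then show ?thesis using 1 \<chi>0 by (simp only: mult.assoc simp_thms)
  qed
  have ev: "eventually (\<lambda>p. prime p \<and> 4 * r + 6 \<le> p) ?F"
    unfolding eventually_inf_principal
    using eventually_ge_at_top[of "4 * r + 6"] by eventually_elim simp
  show ?thesis
  proof (rule bigthetaI)
    show "?h \<in> O[?F](\<lambda>p. ?\<chi> p ^ r)"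
    proof (rule bigoI, rule eventually_mono[OF ev])
      fix p assume "prime p \<and> 4 * r + 6 \<le> p"
      with bounds[of p] show "norm (?h p) \<le> 16 ^ r * norm (?\<chi> p ^ r)"
        by (simp add: abs_of_nonneg)
    qed
    have "(\<lambda>p. ?\<chi> p ^ r) \<in> O[?F](?h)"
    proof (rule bigoI, rule eventually_mono[OF ev])
      fix p assume "prime p \<and> 4 * r + 6 \<le> p"
      with bounds[of p] show "norm (?\<chi> p ^ r) \<le> ((real r ^ 2) ^ r * K) * norm (?h p)"
        by (simp add: abs_of_nonneg)
    qed
    then show "?h \<in> \<Omega>[?F](\<lambda>p. ?\<chi> p ^ r)"
      by (simp only: bigomega_iff_bigo)
  qed
qed

end
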